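(* Consider the convex quadratic semidefinite program $$(\mathrm P)\quad \min_{x\in\mathbb{X}}\ \tfrac12\langle x,\mathcal Qx\rangle+\langle c,x\rangle\quad\text{s.t.}\quad \mathcal Hx-p=0,\ \ \mathcal Gx-q\in\mathbb{S}^n_+,$$ and its (restricted Wolfe) dual $$(\mathrm D)\quad \min_{\omega\in\mathbb{W},\,\xi\in\mathbb{R}^m,\,\Gamma\in\mathbb{S}^n}\ \tfrac12\langle\omega,\mathcal Q\omega\rangle+\langle p,\xi\rangle+\langle q,\Gamma\rangle\quad\text{s.t.}\quad -\mathcal Q\omega-c-\mathcal H^*\xi-\mathcal G^*\Gamma=0,\ \ \Gamma\in\mathbb{S}^n_-,$$ where $\mathbb{W}\subseteq\mathbb{X}$ is a linear subspace containing $\mathrm{Im}(\mathcal Q)$. (i) Suppose $\mathbb{W}=\mathbb{X}$. Let $\overline x\in\mathbb{X}$ be a stationary point of $(\mathrm P)$ with a Lagrange multiplier $(\overline\xi,\overline\Gamma)\in M(\overline x)$. Then the weak second order condition (W-SOC) for $(\mathrm P)$ holds at $(\overline x,\overline\xi,\overline\Gamma)$ if and only if the weak strict Robinson constraint qualification (W-SRCQ) for $(\mathrm D)$ holds at $(\overline x,\overline\xi,\overline\Gamma,\overline x,\mathcal G\overline x-q)$, i.e., at the dual stationary point $(\omega,\xi,\Gamma)=(\overline x,\overline\xi,\overline\Gamma)$ with respect to the multiplier $(\tau,\Upsilon)=(\overline x,\mathcal G\overline x-q)$. (ii) Suppose $\mathbb{W}=\mathrm{Im}(\mathcal Q)$.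 Let $(\overline\omega,\overline\xi,\overline\Gamma)\in\mathbb{W}\times\mathbb{R}^m\times\mathbb{S}^n$ be a stationary point of $(\mathrm D)$ with a Lagrange multiplier $(\overline x,\overline\Upsilon)\in M(\overline\omega,\overline\xi,\overline\Gamma)$. Then the W-SOC for $(\mathrm D)$ holds at $(\overline\omega,\overline\xi,\overline\Gamma,\overline x,\overline\Upsilon)$ if and only if the W-SRCQ for $(\mathrm P)$ holds at $(\overline x,\overline\xi,\overline\Gamma)$.
   Context: Data. $\mathbb{X}$ is a finite-dimensional real Euclidean space; $\mathbb{S}^n$ is the space of real symmetric $n\times n$ matrices with the trace inner product; $\mathbb{S}^n_+$, $\mathbb{S}^n_-$ are the cones of positive, respectively negative, semidefinite matrices. $c\in\mathbb{X}$, $p\in\mathbb{R}^m$, $q\in\mathbb{S}^n$; $\mathcal Q:\mathbb{X}\to\mathbb{X}$ is self-adjoint positive semidefinite linear; $\mathcal H:\mathbb{X}\to\mathbb{R}^m$ and $\mathcal G:\mathbb{X}\to\mathbb{S}^n$ are linear. General definitions. For a problem $\min\{\phi(u):G(u)\in K\}$ with $u$ in a Euclidean space $\mathbb{U}$, $G:\mathbb{U}\to\mathbb{Y}$, $K\subseteq\mathbb{Y}$ closed convex ($\phi$, $G$ twice continuously differentiable), the Lagrangian is $L(u,y)=\phi(u)+\langle y,G(u)\rangle$; $(u,y)$ is a KKT point if $\nabla_uL(u,y)=0$ and $y\in\mathcal N_K(G(u))$ (normal cone of convex analysis); $M(u)$ is the set of $y$ (Lagrange multipliers) such that $(u,y)$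 is a KKT point; $u$ is stationary if $M(u)\neq\emptyset$. Here $\mathcal T_K(z)$ is the tangent cone $\{d:\exists\,t^k\downarrow0,\ \mathrm{dist}(z+t^kd,K)=o(t^k)\}$; $\mathcal T_K^2(z,d)=\{w:\exists\,t^k\downarrow0,\ \mathrm{dist}(z+t^kd+\tfrac12(t^k)^2w,K)=o((t^k)^2)\}$ is the second order tangent set; $\sigma(y,S)=\sup_{s\in S}\langle y,s\rangle$; $y^\perp=\{s:\langle s,y\rangle=0\}$; for a convex cone $C$, $\mathrm{aff}(C)$ is the smallest subspace containing $C$ and $\mathrm{lin}(C)$ the largest subspace contained in $C$. At a KKT point $(\overline u,\overline y)$: - W-SRCQ holds at $\overline u$ with respect to $\overline y$ if $G'(\overline u)\mathbb{U}+\mathrm{aff}\big(\mathcal T_K(G(\overline u))\cap\overline y^\perp\big)=\mathbb{Y}$. - W-SOC holds at $(\overline u,\overline y)$ if $\langle\Delta u,\nabla^2_{uu}L(\overline u,\overline y)\Delta u\rangle-\sigma\big(\overline y,\mathcal T_K^2(G(\overline u),G'(\overline u)\Delta u)\big)>0$ for every nonzero $\Delta u\in\mathbb{U}$ with $G'(\overline u)\Delta u\in\mathrm{lin}\big(\mathcal T_K(G(\overline u))\cap\overline y^\perp\big)$. For $(\mathrm P)$: $\mathbb{U}=\mathbb{X}$, $G(x)=(\mathcal Hx-p,\mathcal Gx-q)$, $K=\{0\}\times\mathbb{S}^n_+\subseteq\mathbb{R}^m\times\mathbb{S}^n$, multiplier $y=(\xi,\Gamma)$. For $(\mathrm D)$: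 $\mathbb{U}=\mathbb{W}\times\mathbb{R}^m\times\mathbb{S}^n$, $G(\omega,\xi,\Gamma)=(-\mathcal Q\omega-c-\mathcal H^*\xi-\mathcal G^*\Gamma,\ \Gamma)$, $K=\{0\}\times\mathbb{S}^n_-\subseteq\mathbb{X}\times\mathbb{S}^n$, multiplier $y=(\tau,\Upsilon)\in\mathbb{X}\times\mathbb{S}^n$; its KKT system is $\mathcal Q\omega-\mathcal Q\tau=0$, $p-\mathcal H\tau=0$, $q-\mathcal G\tau+\Upsilon=0$, $\mathcal Q\omega+c+\mathcal H^*\xi+\mathcal G^*\Gamma=0$, $\Upsilon\in\mathcal N_{\mathbb{S}^n_-}(\Gamma)$. (In (i), $(\overline x,\overline\xi,\overline\Gamma,\overline x,\mathcal G\overline x-q)$ is a KKT point of $(\mathrm D)$; in (ii), $(\overline x,\overline\xi,\overline\Gamma)$ is a KKT point of $(\mathrm P)$.) *)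

theory Defs
  imports "HOL-Analysis.Analysis" "HOL-Library.Landau_Symbols"
begin

section \<open>Tangent cones, normal cones, support functions\<close>

definition tangent_cone :: "'y::euclidean_space set \<Rightarrow> 'y \<Rightarrow> 'y set" where
  "tangent_cone K z =
    {d. \<exists>t::nat \<Rightarrow> real. (\<forall>k. 0 < t k) \<and> t \<longlonglongrightarrow> 0 \<and>
      (\<lambda>k. infdist (z + t k *\<^sub>R d) K) \<in> o(t)}"

definition second_tangent_set :: "'y::euclidean_space set \<Rightarrow> 'y \<Rightarrow> 'y \<Rightarrow> 'y set" where
  "second_tangent_set K z d =
    {w. \<exists>t::nat \<Rightarrow> real. (\<forall>k. 0 < t k) \<and> t \<longlonglongrightarrow> 0 \<and>
      (\<lambda>k. infdist (z + t k *\<^sub>R d + ((t k)\<^sup>2 / 2) *\<^sub>R w) K) \<in> o(\<lambda>k. (t k)\<^sup>2)}"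

definition normal_cone :: "'y::euclidean_space set \<Rightarrow> 'y \<Rightarrow> 'y set" where
  "normal_cone K z = (if z \<in> K then {y. \<forall>k\<in>K. y \<bullet> (k - z) \<le> 0} else {})"

text \<open>Extended-real valued, with value \<open>-\<infinity>\<close> on the empty set.\<close>

definition support_fun :: "'y::euclidean_space \<Rightarrow> 'y set \<Rightarrow> ereal" where
  "support_fun y S = (SUP s\<in>S. ereal (y \<bullet> s))"

definition orth_compl_of :: "'y::euclidean_space \<Rightarrow> 'y set" where
  "orth_compl_of y = {s. s \<bullet> y = 0}"

text \<open>The largest subspace contained in a convex cone; its counterpart, the smallest
  subspace containing it, is \<open>span\<close>.\<close>

definition lineality :: "'y::euclidean_space set \<Rightarrow> 'y set" where
  "lineality C = (GREATEST S. subspace S \<and> S \<subseteq> C)"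


section \<open>Constrained programs on Euclidean spaces\<close>

text \<open>The Euclidean spaces \<open>U\<close> of variables and \<open>Y\<close> of constraint values are represented as
  linear subspaces of ambient types, with the induced inner products. This is
  needed for symmetric matrices and for a variable confined to a subspace \<open>W\<close>.\<close>

record ('u, 'y) program =
  var_space :: "'u set"
  con_space :: "'y set"
  objective :: "'u \<Rightarrow> real"
  con_map :: "'u \<Rightarrow> 'y"
  con_set :: "'y set"

text \<open>Gradient and Hessian of \<open>f\<close> restricted to a subspace \<open>U\<close>. A derivative \<open>within U\<close> is
  determined only along \<open>U\<close>, so derivatives are only ever applied to directions in \<open>U\<close>; the
  gradient is made unique by requiring it to lie in \<open>U\<close>.\<close>

definition gradient_on :: "'u::euclidean_space set \<Rightarrow> ('u \<Rightarrow> real) \<Rightarrow> 'u \<Rightarrow> 'u" where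
  "gradient_on U f u = (THE g. g \<in> U \<and> (f has_derivative (\<lambda>h. g \<bullet> h)) (at u within U))"

definition hessian_on :: "'u::euclidean_space set \<Rightarrow> ('u \<Rightarrow> real) \<Rightarrow> 'u \<Rightarrow> 'u \<Rightarrow> 'u" where
  "hessian_on U f u = frechet_derivative (gradient_on U f) (at u within U)"

definition lagrangian ::
  "('u::euclidean_space, 'y::euclidean_space) program \<Rightarrow> 'u \<Rightarrow> 'y \<Rightarrow> real" where
  "lagrangian P u y = objective P u + y \<bullet> con_map P u"

definition con_deriv ::
  "('u::euclidean_space, 'y::euclidean_space) program \<Rightarrow> 'u \<Rightarrow> 'u \<Rightarrow> 'y" where
  "con_deriv P u = frechet_derivative (con_map P) (at u within var_space P)"

definition kkt_point ::
  "('u::euclidean_space, 'y::euclidean_space) program \<Rightarrow> 'u \<Rightarrow> 'y \<Rightarrow> bool" where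
  "kkt_point P u y \<longleftrightarrow>
    u \<in> var_space P \<and> y \<in> con_space P \<and>
    gradient_on (var_space P) (\<lambda>v. lagrangian P v y) u = 0 \<and>
    y \<in> normal_cone (con_set P) (con_map P u)"

definition multipliers ::
  "('u::euclidean_space, 'y::euclidean_space) program \<Rightarrow> 'u \<Rightarrow> 'y set" where
  "multipliers P u = {y. kkt_point P u y}"

definition stationary_point ::
  "('u::euclidean_space, 'y::euclidean_space) program \<Rightarrow> 'u \<Rightarrow> bool" where
  "stationary_point P u \<longleftrightarrow> multipliers P u \<noteq> {}"

text \<open>If \<open>con_set P \<subseteq> con_space P\<close> and \<open>z\<close> is in the subspace \<open>con_space P\<close>, then
  \<open>tangent_cone (con_set P) z\<close> lies in \<open>con_space P\<close>; for \<open>d\<close> in \<open>con_space P\<close> so does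
  \<open>second_tangent_set (con_set P) z d\<close>. No intersection with \<open>con_space P\<close> is needed.
  W-SRCQ and W-SOC are notions for KKT points only.\<close>

definition W_SRCQ ::
  "('u::euclidean_space, 'y::euclidean_space) program \<Rightarrow> 'u \<Rightarrow> 'y \<Rightarrow> bool" where
  "W_SRCQ P u y \<longleftrightarrow>
    kkt_point P u y \<and>
    {a + b | a b. a \<in> con_deriv P u ` var_space P \<and>
       b \<in> span (tangent_cone (con_set P) (con_map P u) \<inter> orth_compl_of y)} = con_space P"

definition W_SOC ::
  "('u::euclidean_space, 'y::euclidean_space) program \<Rightarrow> 'u \<Rightarrow> 'y \<Rightarrow> bool" where
  "W_SOC P u y \<longleftrightarrow>
    kkt_point P u y \<and>
    (\<forall>d \<in> var_space P. d \<noteq> 0 \<longrightarrow>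
       con_deriv P u d \<in> lineality (tangent_cone (con_set P) (con_map P u) \<inter> orth_compl_of y) \<longrightarrow>
       ereal (d \<bullet> hessian_on (var_space P) (\<lambda>v. lagrangian P v y) u d)
         - support_fun y (second_tangent_set (con_set P) (con_map P u) (con_deriv P u d)) > 0)"


section \<open>Symmetric matrices\<close>

definition sym_mats :: "(real^'n^'n) set" where
  "sym_mats = {A. transpose A = A}"

definition psd_cone :: "(real^'n^'n) set" where
  "psd_cone = {A \<in> sym_mats. \<forall>v. 0 \<le> v \<bullet> (A *v v)}"

definition nsd_cone :: "(real^'n^'n) set" where
  "nsd_cone = {A \<in> sym_mats. \<forall>v. v \<bullet> (A *v v) \<le> 0}"

text \<open>The library inner product on matrices is the trace inner product.\<close>

lemma inner_eq_trace:
  fixes A B :: "real^'n^'n"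
  shows "A \<bullet> B = trace (transpose A ** B)"
  unfolding inner_vec_def trace_def matrix_matrix_mult_def transpose_def
  by (simp, subst sum.swap, simp)


section \<open>Convex quadratic semidefinite programs and their restricted Wolfe duals\<close>

definition qsdp_primal ::
  "('x::euclidean_space \<Rightarrow> 'x) \<Rightarrow> 'x \<Rightarrow> ('x \<Rightarrow> real^'m) \<Rightarrow> real^'m \<Rightarrow>
   ('x \<Rightarrow> real^'n^'n) \<Rightarrow> real^'n^'n \<Rightarrow> ('x, (real^'m) \<times> (real^'n^'n)) program" where
  "qsdp_primal Q c H p G q =
    \<lparr> var_space = UNIV,
      con_space = UNIV \<times> sym_mats,
      objective = (\<lambda>x. (x \<bullet> Q x) / 2 + c \<bullet> x),
      con_map = (\<lambda>x. (H x - p, G x - q)),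
      con_set = {0} \<times> psd_cone \<rparr>"

text \<open>For \<open>G\<close> with range in the symmetric matrices, \<open>adjoint G\<close> agrees on symmetric matrices with
  the adjoint of \<open>G\<close> as a map into the space of symmetric matrices.\<close>

definition qsdp_dual ::
  "'x::euclidean_space set \<Rightarrow> ('x \<Rightarrow> 'x) \<Rightarrow> 'x \<Rightarrow> ('x \<Rightarrow> real^'m) \<Rightarrow> real^'m \<Rightarrow>
   ('x \<Rightarrow> real^'n^'n) \<Rightarrow> real^'n^'n \<Rightarrow>
   ('x \<times> (real^'m) \<times> (real^'n^'n), 'x \<times> (real^'n^'n)) program" where
  "qsdp_dual W Q c H p G q =
    \<lparr> var_space = W \<times> UNIV \<times> sym_mats,
      con_space = UNIV \<times> sym_mats,
      objective = (\<lambda>(\<omega>, \<xi>, \<Gamma>). (\<omega> \<bullet> Q \<omega>) / 2 + p \<bullet> \<xi> + q \<bullet> \<Gamma>),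
      con_map = (\<lambda>(\<omega>, \<xi>, \<Gamma>). (- Q \<omega> - c - adjoint H \<xi> - adjoint G \<Gamma>, \<Gamma>)),
      con_set = {0} \<times> nsd_cone \<rparr>"

end

theory Submission
  imports Defs
begin

text \<open>
  Let \<open>Z = G x - q\<close> and \<open>\<Gamma>\<close> be complementary. A direction \<open>D\<close> lies in the lineality space of the primal
  critical cone iff it vanishes as a quadratic form on \<open>ker Z\<close>, i.e. iff \<open>D = Z B + B\<^sup>T Z\<close> for some \<open>B\<close>.
  For such \<open>D\<close> the sigma term is \<open>2 \<langle>\<Gamma>, B\<^sup>T Z B\<rangle> \<le> 0\<close>, and it vanishes iff \<open>D \<Gamma> = 0\<close>. Hence W-SOC fails iff
  some nonzero direction has zero curvature and its image \<open>D\<close> vanishes on \<open>ker Z\<close> with \<open>D \<Gamma> = 0\<close>. These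
  two conditions on \<open>D\<close> describe exactly the orthogonal complement of the dual critical cone, so such
  directions are the vectors orthogonal to the sum in W-SRCQ of the other problem. The roles of \<open>Z\<close>
  and \<open>\<Gamma>\<close> are exchanged by \<open>(Z, \<Gamma>) \<mapsto> (- \<Gamma>, - Z)\<close>, which settles (ii) in the same way; there
  \<open>W = Im Q\<close> forces the \<open>\<omega>\<close>-component to be zero, because \<open>Q\<close> is injective on its range.
\<close>

section \<open>Real square and semidefinite matrices\<close>

lemma bilinear_matrix_mult: "bilinear ((**) :: real^'n^'n \<Rightarrow> real^'n^'n \<Rightarrow> real^'n^'n)"
  unfolding bilinear_def
  by (auto intro!: linearI simp: matrix_matrix_mult_def vec_eq_iff algebra_simps sum.distrib sum_distrib_left)

lemmas matrix_mult_algebra =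
  bilinear_ladd[OF bilinear_matrix_mult] bilinear_radd[OF bilinear_matrix_mult]
  bilinear_lsub[OF bilinear_matrix_mult] bilinear_rsub[OF bilinear_matrix_mult]
  bilinear_lmul[OF bilinear_matrix_mult] bilinear_rmul[OF bilinear_matrix_mult]
  bilinear_lneg[OF bilinear_matrix_mult] bilinear_rneg[OF bilinear_matrix_mult]

lemmas matrix_mult_zero [simp] =
  bilinear_lzero[OF bilinear_matrix_mult] bilinear_rzero[OF bilinear_matrix_mult]

lemma linear_transpose: "linear (transpose :: real^'n^'n \<Rightarrow> real^'n^'n)"
  by (auto intro!: linearI simp: transpose_def vec_eq_iff)

lemmas transpose_linear [simp] =
  linear_add[OF linear_transpose] linear_diff[OF linear_transpose]
  linear_neg[OF linear_transpose] linear_scale[OF linear_transpose] linear_0[OF linear_transpose]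

lemma inner_matrix_mult_left:
  fixes A B C :: "real^'n^'n"
  shows "(A ** B) \<bullet> C = B \<bullet> (transpose A ** C)"
  by (simp add: inner_eq_trace matrix_transpose_mul matrix_mul_assoc)

lemma inner_matrix_mult_right:
  fixes A B C :: "real^'n^'n"
  shows "(A ** B) \<bullet> C = A \<bullet> (C ** transpose B)"
  by (metis inner_eq_trace matrix_transpose_mul matrix_mul_assoc trace_mul_sym)

lemma inner_transpose:
  fixes A B :: "real^'n^'n"
  shows "transpose A \<bullet> transpose B = A \<bullet> B"
  by (simp add: inner_vec_def transpose_def) (rule sum.swap)

lemma inner_transpose_left:
  fixes A B :: "real^'n^'n"
  shows "transpose A \<bullet> B = A \<bullet> transpose B"
  by (metis inner_transpose transpose_transpose)

lemma quadratic_form_congruence: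
  fixes A M :: "real^'n^'n"
  shows "u \<bullet> ((transpose A ** M ** A) *v u) = (A *v u) \<bullet> (M *v (A *v u))"
  by (metis dot_lmul_matrix matrix_vector_mul_assoc transpose_matrix_vector inner_commute)

section \<open>Rank-one squares and symmetric matrices\<close>

definition outer_square :: "real^'n \<Rightarrow> real^'n^'n" where
  "outer_square u = (\<chi> i j. u $ i * u $ j)"

text \<open>Makes each value of a quadratic form a linear functional of the matrix. Closedness of
  the cone, the sign of a normal vector and the tests on tangent directions all use this.\<close>

lemma inner_outer_square: "A \<bullet> outer_square u = u \<bullet> (A *v u)"
  by (simp add: outer_square_def inner_vec_def matrix_vector_mult_def sum_distrib_left algebra_simps)

lemma outer_square_mult: "outer_square u *v v = (u \<bullet> v) *\<^sub>R u"
  by (simp add: outer_square_def inner_vec_def matrix_vector_mult_def vec_eq_iff sum_distrib_left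
      mult_ac)

lemma transpose_outer_square [simp]: "transpose (outer_square u) = outer_square u"
  by (simp add: outer_square_def transpose_def vec_eq_iff mult.commute)

lemma mult_outer_square_eq_0:
  assumes "A *v u = 0"
  shows "A ** outer_square u = 0"
  using assms
  by (simp add: matrix_eq outer_square_mult matrix_vector_mult_scaleR flip: matrix_vector_mul_assoc)

lemma subspace_sym_mats: "subspace sym_mats"
  by (auto simp: subspace_def sym_mats_def)

lemma sym_mats_inner:
  assumes "A \<in> sym_mats"
  shows "(A *v u) \<bullet> v = u \<bullet> (A *v v)"
proof -
  have "A *v u = u v* A"
    using assms transpose_matrix_vector[of A u] by (simp add: sym_mats_def)
  then show ?thesis
    by (simp add: dot_lmul_matrix)
qed

text \<open>Polarization: for symmetric \<open>A\<close> the form at \<open>u + v\<close> exposes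
  twice the mixed term \<open>u \<bullet> (A *v v)\<close>.\<close>

lemma sym_form_zero_imp_zero:
  fixes A :: "real^'n^'n"
  assumes "A \<in> sym_mats" and z: "\<And>u. u \<bullet> (A *v u) = 0"
  shows "A = 0"
proof -
  have "u \<bullet> (A *v v) = 0" for u v
    using z[of "u + v"] z[of u] z[of v] sym_mats_inner[OF assms(1), of v u]
    by (simp add: matrix_vector_right_distrib inner_add_left inner_add_right inner_commute)
  then have "A *v v = 0" for v
    using inner_eq_zero_iff by blast
  then show ?thesis
    by (simp add: matrix_eq)
qed

section \<open>The cone of positive semidefinite matrices\<close>

lemma psd_cone_sym: "A \<in> psd_cone \<Longrightarrow> A \<in> sym_mats"
  and psd_cone_form: "A \<in> psd_cone \<Longrightarrow> 0 \<le> u \<bullet> (A *v u)"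
  by (auto simp: psd_cone_def)

lemma zero_in_psd_cone [simp]: "0 \<in> psd_cone"
  by (simp add: psd_cone_def subspace_0[OF subspace_sym_mats])

lemma outer_square_psd: "outer_square u \<in> psd_cone"
  by (simp add: psd_cone_def sym_mats_def outer_square_mult inner_commute)

lemma psd_cone_add:
  assumes "A \<in> psd_cone" "B \<in> psd_cone"
  shows "A + B \<in> psd_cone"
  using assms by (simp add: psd_cone_def matrix_vector_mult_add_rdistrib inner_add_right
      subspace_add[OF subspace_sym_mats])

lemma psd_cone_scale:
  assumes "A \<in> psd_cone" "0 \<le> r"
  shows "r *\<^sub>R A \<in> psd_cone"
  using assms by (simp add: psd_cone_def scaleR_matrix_vector_assoc[symmetric]
      subspace_scale[OF subspace_sym_mats])

lemma psd_cone_congruence: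
  fixes A M :: "real^'n^'n"
  assumes "M \<in> psd_cone"
  shows "transpose A ** M ** A \<in> psd_cone"
  using assms
  by (auto simp: psd_cone_def sym_mats_def quadratic_form_congruence matrix_transpose_mul
       matrix_mul_assoc simp del: transpose_matrix_vector)

lemma closed_psd_cone: "closed (psd_cone :: (real^'n^'n) set)"
proof -
  have "psd_cone = sym_mats \<inter> (\<Inter>u. {A :: real^'n^'n. 0 \<le> A \<bullet> outer_square u})"
    by (auto simp: psd_cone_def inner_outer_square)
  moreover have "closed \<dots>"
    by (intro closed_Int closed_INT ballI closed_Collect_le continuous_intros
        closed_subspace subspace_sym_mats)
  ultimately show ?thesis
    by simp
qed

lemma uminus_matrix_vector_mult: "(- A) *v u = - (A *v (u :: real^'n))"
  by (simp add: matrix_vector_mult_def vec_eq_iff sum_negf)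

lemma uminus_psd_cone: "uminus ` psd_cone = nsd_cone"
  by (force simp: psd_cone_def nsd_cone_def uminus_matrix_vector_mult
      subspace_neg[OF subspace_sym_mats] intro: image_eqI[of _ _ "- x" for x])

text \<open>Otherwise a small step from \<open>u\<close> along \<open>- Q u\<close> would make the
  form negative, since its first-order change is \<open>- 2 t |Q u|^2\<close>. Stated for operators
  so that it serves both matrices and the quadratic objective.\<close>

lemma self_adjoint_psd_form_zero_imp:
  fixes Q :: "'a::euclidean_space \<Rightarrow> 'a"
  assumes "linear Q" and sym: "\<And>x y. Q x \<bullet> y = x \<bullet> Q y" and psd: "\<And>x. 0 \<le> x \<bullet> Q x"
    and z: "u \<bullet> Q u = 0"
  shows "Q u = 0"
proof -
  define w where "w = Q u"
  have "w \<bullet> w \<le> e" if "e > 0" for e :: real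
  proof -
    define b where "b = w \<bullet> Q w"
    have b: "b \<ge> 0" using psd by (simp add: b_def)
    \<comment> \<open>The shift by one keeps the denominator positive when \<open>b = 0\<close> and
      still gives \<open>t * b \<le> e\<close>.\<close>
    define t where "t = e / (b + 1)"
    have t: "t > 0" using that b by (simp add: t_def)
    have "0 \<le> (u - t *\<^sub>R w) \<bullet> Q (u - t *\<^sub>R w)"
      by (rule psd)
    also have "\<dots> = t * (t * b - 2 * (w \<bullet> w))"
      using z sym[of u w]
      by (simp add: linear_diff[OF assms(1)] linear_scale[OF assms(1)] inner_diff_left
          inner_diff_right b_def[symmetric] w_def[symmetric] algebra_simps)
    finally have "2 * (w \<bullet> w) \<le> t * b"
      using t by (simp add: zero_le_mult_iff)
    also have "\<dots> \<le> e"
      using b that by (simp add: t_def field_simps)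
    finally show ?thesis
      using inner_ge_zero[of w] by linarith
  qed
  then have "w \<bullet> w \<le> 0"
    by (rule field_le_epsilon[of _ 0, simplified])
  then show ?thesis
    by (metis w_def inner_eq_zero_iff inner_ge_zero order_antisym)
qed

lemma psd_form_zero_imp:
  assumes "A \<in> psd_cone" "u \<bullet> (A *v u) = 0"
  shows "A *v u = 0"
  by (rule self_adjoint_psd_form_zero_imp[of "(*v) A"])
     (simp_all add: sym_mats_inner psd_cone_sym psd_cone_form assms)

text \<open>Stands in for the spectral theorem: a semidefinite matrix is a finite sum of outer
  squares. If the form is nonzero at \<open>v\<close>, subtracting the rank-one matrix built from
  \<open>A *v v\<close> keeps semidefiniteness and shrinks the range, so the dimension of the range
  decreases.\<close>

lemma psd_cone_induct [consumes 1, case_names zero add]: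
  assumes "A \<in> psd_cone"
    and zero: "P 0"
    and add: "\<And>A u. A \<in> psd_cone \<Longrightarrow> P A \<Longrightarrow> P (A + outer_square u)"
  shows "P A"
  using assms(1)
proof (induction "dim (range ((*v) A))" arbitrary: A rule: less_induct)
  case less
  note A = less.prems
  show ?case
  proof (cases "A = 0")
    case True
    then show ?thesis by (simp add: zero)
  next
    case False
    then obtain v where v: "v \<bullet> (A *v v) \<noteq> 0"
      using sym_form_zero_imp_zero psd_cone_sym[OF A] by blast
    define s where "s = v \<bullet> (A *v v)"
    have s: "s > 0" using v psd_cone_form[OF A, of v] by (simp add: s_def)
    \<comment> \<open>Scaled so that subtracting the outer square of \<open>u\<close> is one step of
      symmetric elimination, which puts \<open>v\<close> into the kernel of
      \<open>B\<close>.\<close>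
    define u where "u = (1 / sqrt s) *\<^sub>R (A *v v)"
    define B where "B = A - outer_square u"
    have Bv: "B *v x = A *v x - ((A *v v) \<bullet> x / s) *\<^sub>R (A *v v)" for x
      using s by (simp add: B_def matrix_vector_mult_diff_rdistrib outer_square_mult u_def
          real_sqrt_mult_self)
    have symA: "(A *v x) \<bullet> y = x \<bullet> (A *v y)" for x y
      by (rule sym_mats_inner[OF psd_cone_sym[OF A]])
    have B: "B \<in> psd_cone"
      unfolding psd_cone_def
    proof (intro CollectI conjI allI)
      show "B \<in> sym_mats"
        using psd_cone_sym[OF A] by (simp add: B_def sym_mats_def)
      fix x
      \<comment> \<open>This \<open>r\<close> minimizes the form of \<open>A\<close> along
        \<open>x - r v\<close>; the minimum is the form of \<open>B\<close> at
        \<open>x\<close>.\<close>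
      define r where "r = (A *v v) \<bullet> x / s"
      have "0 \<le> (x - r *\<^sub>R v) \<bullet> (A *v (x - r *\<^sub>R v))"
        by (rule psd_cone_form[OF A])
      also have "\<dots> = x \<bullet> (A *v x) - 2 * r * ((A *v v) \<bullet> x) + r * r * s"
        by (simp add: matrix_vector_mult_diff_distrib matrix_vector_mult_scaleR inner_diff_left
          inner_diff_right s_def symA algebra_simps) (metis symA inner_commute)
      also have "\<dots> = x \<bullet> (B *v x)"
        using s by (simp add: Bv r_def inner_diff_right field_simps inner_commute)
      finally show "0 \<le> x \<bullet> (B *v x)" .
    qed
    have "range ((*v) B) \<subset> range ((*v) A)"
    proof -
      have "B *v x = A *v (x - ((A *v v) \<bullet> x / s) *\<^sub>R v)" for x
        by (simp add: Bv matrix_vector_mult_diff_distrib matrix_vector_mult_scaleR)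
      then have "range ((*v) B) \<subseteq> range ((*v) A)"
        by auto
      \<comment> \<open>Every vector in the range of \<open>B\<close> is orthogonal to
        \<open>v\<close>, whereas \<open>v \<bullet> (A *v v) = s > 0\<close>.\<close>
      moreover have "A *v v \<notin> range ((*v) B)"
      proof
        assume "A *v v \<in> range ((*v) B)"
        then obtain x where "A *v v = B *v x" by auto
        then have "s = v \<bullet> (B *v x)"
          by (simp add: s_def)
        also have "\<dots> = 0"
          using s by (simp add: Bv inner_diff_right symA flip: s_def)
        finally show False using s by simp
      qed
      ultimately show ?thesis by blast
    qed
    then have "dim (range ((*v) B)) < dim (range ((*v) A))"
      by (metis dim_psubset span_eq_iff linear_subspace_image subspace_UNIV matrix_vector_mul_linear)
    then have "P B" using less.hyps B by blast
    then show ?thesis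
      using add[OF B, of u] by (simp add: B_def)
  qed
qed

lemma psd_inner_nonneg:
  assumes "A \<in> psd_cone" "B \<in> psd_cone"
  shows "0 \<le> A \<bullet> B"
  using assms(1)
proof (induction rule: psd_cone_induct)
  case (add A u)
  then show ?case
    using psd_cone_form[OF assms(2), of u]
    by (simp add: inner_add_left inner_outer_square inner_commute[of "outer_square u"])
qed simp

text \<open>Along the rank-one decomposition of \<open>A\<close> the pairing is a sum of nonnegative
  terms. All of them vanish, so \<open>B\<close> kills every vector \<open>u\<close> in the
  decomposition.\<close>

lemma psd_inner_zero_imp_mult_zero:
  assumes "A \<in> psd_cone" "B \<in> psd_cone" "A \<bullet> B = 0"
  shows "B ** A = 0"
  using assms(1,3)
proof (induction rule: psd_cone_induct)
  case (add A u)
  have "A \<bullet> B \<ge> 0" "u \<bullet> (B *v u) \<ge> 0"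
    using add psd_inner_nonneg psd_cone_form assms(2) by blast+
  moreover have "A \<bullet> B + u \<bullet> (B *v u) = 0"
    using add.prems by (simp add: inner_add_left inner_outer_square inner_commute[of "outer_square u"])
  ultimately have "A \<bullet> B = 0" "u \<bullet> (B *v u) = 0"
    by linarith+
  then show ?case
    using add.IH mult_outer_square_eq_0[OF psd_form_zero_imp[OF assms(2), of u]]
    by (simp add: matrix_mult_algebra)
qed simp

text \<open>\<open>P\<close> is the orthogonal projection onto the range of \<open>Z\<close>, found
  without eigenvalues: \<open>Z\<close> and \<open>Z ** Z\<close> have the same range, so
  \<open>Z ** Z ** A = Z\<close> is solvable and \<open>P = Z ** A\<close> works. Both
  factorizations of \<open>P\<close> are kept because later factors are absorbed on either
  side.\<close>

lemma sym_range_projection: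
  fixes Z :: "real^'n^'n"
  assumes "Z \<in> sym_mats"
  obtains P A where "P = Z ** A" "P = transpose A ** Z" "transpose P = P" "Z ** P = Z" "P ** Z = Z"
proof -
  have Z: "transpose Z = Z" using assms by (simp add: sym_mats_def)
  have symZ: "(Z *v x) \<bullet> y = x \<bullet> (Z *v y)" for x y
    by (rule sym_mats_inner[OF assms])
  have "\<exists>a. Z *v (Z *v a) = Z *v v" for v
  proof -
    let ?S = "range (\<lambda>a. Z *v (Z *v a))"
    have lin: "linear (\<lambda>a. Z *v (Z *v a))"
      using linear_compose[OF matrix_vector_mul_linear matrix_vector_mul_linear] by (simp add: o_def)
    have span: "span ?S = ?S"
      by (simp add: span_eq_iff linear_subspace_image[OF lin])
    obtain y z where y: "y \<in> span ?S" and z: "\<And>w. w \<in> span ?S \<Longrightarrow> orthogonal z w"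
      and eq: "Z *v v = y + z"
      using orthogonal_subspace_decomp_exists[where S = ?S and x = "Z *v v"] by metis
    \<comment> \<open>The residual \<open>z\<close> is orthogonal to the range of
      \<open>Z ** Z\<close>; testing it on \<open>Z *v (Z *v z)\<close> gives
      \<open>|Z z|^2 = 0\<close>.\<close>
    have "z \<bullet> (Z *v (Z *v z)) = 0"
      using z by (auto simp: span orthogonal_def)
    then have "Z *v z = 0"
      by (metis symZ inner_eq_zero_iff)
    then have "z \<bullet> (Z *v v) = 0"
      by (metis symZ inner_zero_left)
    then have "z = 0"
      using z[OF y] by (simp add: eq inner_add_right orthogonal_def)
    then show ?thesis using y eq span by auto
  qed
  then obtain a where a: "\<And>v. Z *v (Z *v a v) = Z *v v" by metis
  define A where "A = (\<chi> i j. a (axis j 1) $ i)"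
  have "column j A = a (axis j 1)" for j
    by (simp add: column_def A_def vec_eq_iff)
  then have A: "A *v axis j 1 = a (axis j 1)" for j
    by (simp add: matrix_vector_mult_basis)
  have "Z ** (Z ** A) = Z"
  proof -
    have "column j (Z ** (Z ** A)) = column j Z" for j
      by (metis A a matrix_vector_mult_basis matrix_vector_mul_assoc)
    then show ?thesis
      by (simp add: column_def vec_eq_iff)
  qed
  then have ZZA: "Z ** Z ** A = Z" by (simp add: matrix_mul_assoc)
  have AZZ: "transpose A ** Z ** Z = Z"
    using arg_cong[OF ZZA, of transpose] by (simp add: matrix_transpose_mul Z matrix_mul_assoc)
  \<comment> \<open>The symmetric expression in the middle equals both
    \<open>transpose A ** Z\<close> and \<open>Z ** A\<close>, so these agree.\<close>
  have "transpose A ** Z = transpose A ** Z ** Z ** A"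
    by (metis ZZA matrix_mul_assoc)
  then have e: "transpose A ** Z = Z ** A" by (simp add: AZZ)
  show ?thesis
    by (rule that[of "Z ** A" A]) (use e ZZA AZZ in \<open>simp_all add: matrix_transpose_mul Z matrix_mul_assoc\<close>)
qed

text \<open>\<open>mat 1 - P\<close> maps into the kernel of \<open>Z\<close>, so the compression of
  \<open>D\<close> has zero form, and polarization applies.\<close>

lemma kernel_projection_form_zero:
  fixes Z D P A :: "real^'n^'n"
  assumes "D \<in> sym_mats" "\<And>u. Z *v u = 0 \<Longrightarrow> u \<bullet> (D *v u) = 0"
    "transpose P = P" "Z ** P = Z"
  shows "(mat 1 - P) ** D ** (mat 1 - P) = 0"
proof (rule sym_form_zero_imp_zero)
  let ?F = "mat 1 - P"
  show "?F ** D ** ?F \<in> sym_mats"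
    using assms(1,3) by (simp add: sym_mats_def matrix_transpose_mul matrix_mul_assoc transpose_mat)
  fix u
  have "Z *v (?F *v u) = 0"
    using assms(4) by (simp add: matrix_vector_mul_assoc matrix_mult_algebra)
  then have "(?F *v u) \<bullet> (D *v (?F *v u)) = 0" by (rule assms)
  then show "u \<bullet> ((?F ** D ** ?F) *v u) = 0"
    using quadratic_form_congruence[of u ?F D] assms(3) by (simp add: transpose_mat)
qed

text \<open>The tangent space at a symmetric \<open>Z\<close> to the symmetric matrices of the same
  rank. For semidefinite \<open>Z\<close> it turns out to be the lineality space of the tangent
  cone.\<close>

definition vanishing_on_kernel :: "real^'n^'n \<Rightarrow> (real^'n^'n) set" where
  "vanishing_on_kernel Z = {D \<in> sym_mats. \<forall>u. Z *v u = 0 \<longrightarrow> u \<bullet> (D *v u) = 0}"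

lemma vanishing_on_kernel_decomp:
  assumes "Z \<in> sym_mats" "D \<in> vanishing_on_kernel Z"
  obtains B where "D = Z ** B + transpose B ** Z"
proof -
  obtain P A where P: "P = Z ** A" "P = transpose A ** Z" "transpose P = P" "Z ** P = Z"
    using sym_range_projection[OF assms(1)] by metis
  have D: "transpose D = D" using assms(2) by (simp add: vanishing_on_kernel_def sym_mats_def)
  have Z: "transpose Z = Z" using assms(1) by (simp add: sym_mats_def)
  have "(mat 1 - P) ** D ** (mat 1 - P) = 0"
    using assms(2) P(3,4) by (intro kernel_projection_form_zero[of _ Z]) (auto simp: vanishing_on_kernel_def)
  then have *: "D = P ** D + D ** P - P ** D ** P"
    by (simp add: matrix_mult_algebra algebra_simps)
  \<comment> \<open>The zero compression gives \<open>D = P D + D P - P D P\<close>. Since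
    \<open>Z ** A = P\<close>, half of the overlap \<open>P D P\<close> is removed from each of two
    mutually transposed terms.\<close>
  define B where "B = A ** D - (1/2) *\<^sub>R (A ** D ** P)"
  have "Z ** B = P ** D - (1/2) *\<^sub>R (P ** D ** P)"
    by (simp add: B_def matrix_mult_algebra matrix_mul_assoc P(1)[symmetric])
  moreover have "transpose B ** Z = D ** P - (1/2) *\<^sub>R (P ** D ** P)"
    by (simp add: B_def matrix_mult_algebra matrix_transpose_mul D P(3) flip: matrix_mul_assoc P(2))
  ultimately have "Z ** B + transpose B ** Z = P ** D + D ** P - P ** D ** P"
    by (metis (no_types, lifting) add_diff_eq add_diff_add diff_diff_eq field_sum_of_halves scaleR_left_distrib scaleR_one)
  then show ?thesis using that * by metis
qed

lemma subspace_vanishing_on_kernel: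
  "subspace (vanishing_on_kernel Z)"
  unfolding subspace_def vanishing_on_kernel_def
  by (auto simp: subspace_0 subspace_add subspace_scale subspace_sym_mats
      matrix_vector_mult_add_rdistrib inner_add_right scaleR_matrix_vector_assoc[symmetric])

section \<open>Tangent sets under products and reflection\<close>

lemma smallo_mono:
  fixes f g h :: "nat \<Rightarrow> real"
  assumes "g \<in> o(h)" "\<And>k. 0 \<le> f k" "\<And>k. f k \<le> g k"
  shows "f \<in> o(h)"
proof (rule landau_o.big_small_trans[OF _ assms(1)])
  show "f \<in> O(g)"
    using assms(2,3) by (intro bigoI[of _ 1]) (simp add: order_trans[OF _ abs_ge_self])
qed

lemma infdist_zero_times:
  fixes a :: "'a::euclidean_space" and b :: "'b::euclidean_space"
  assumes "K \<noteq> {}"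
  shows norm_le_infdist_zero_times: "norm a \<le> infdist (a, b) ({0} \<times> K)"
    and infdist_le_infdist_zero_times: "infdist b K \<le> infdist (a, b) ({0} \<times> K)"
    and infdist_zero_times_zero: "infdist (0, b) ({0::'a} \<times> K) = infdist b K"
proof -
  have ne: "{0::'a} \<times> K \<noteq> {}" using assms by auto
  show "norm a \<le> infdist (a, b) ({0} \<times> K)"
    unfolding infdist_notempty[OF ne]
    by (rule cINF_greatest[OF ne]) (auto simp: dist_norm norm_fst_le)
  have *: "infdist b K \<le> infdist (a, b) ({0} \<times> K)" for a :: 'a
    unfolding infdist_notempty[OF ne]
    by (rule cINF_greatest[OF ne])
       (auto simp: dist_Pair_Pair intro: infdist_le2 order_trans[OF _ real_sqrt_sum_squares_ge2])
  show "infdist b K \<le> infdist (a, b) ({0} \<times> K)" by (rule *)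
  have "infdist (0, b) ({0::'a} \<times> K) \<le> infdist b K"
    unfolding infdist_notempty[OF assms]
  proof (rule cINF_greatest[OF assms])
    fix k assume "k \<in> K"
    then show "infdist (0, b) ({0::'a} \<times> K) \<le> dist b k"
      by (intro infdist_le2[of "(0, k)"]) (simp_all add: dist_Pair_Pair)
  qed
  then show "infdist (0, b) ({0::'a} \<times> K) = infdist b K"
    using *[of 0] by simp
qed

lemma tangent_cone_zero_times:
  fixes z :: "'b::euclidean_space"
  assumes "K \<noteq> {}"
  shows "tangent_cone ({0::'a::euclidean_space} \<times> K) (0, z) = {0} \<times> tangent_cone K z"
proof (intro set_eqI iffI)
  fix d :: "'a \<times> 'b"
  assume "d \<in> tangent_cone ({0} \<times> K) (0, z)"
  then obtain a b t where d: "d = (a, b)" and t: "\<forall>k. 0 < t k" "t \<longlonglongrightarrow> 0"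
    and o: "(\<lambda>k. infdist (t k *\<^sub>R a, z + t k *\<^sub>R b) ({0} \<times> K)) \<in> o(t)"
    by (cases d) (auto simp: tangent_cone_def)
  have "(\<lambda>k. norm (t k *\<^sub>R a)) \<in> o(t)"
    by (rule smallo_mono[OF o norm_ge_zero norm_le_infdist_zero_times[OF assms]])
  \<comment> \<open>Division by \<open>t k\<close> leaves the constant sequence
    \<open>norm a\<close>, so a tangent direction has no component along the equality
    constraint.\<close>
  from smalloD_tendsto[OF this] have "(\<lambda>k::nat. norm a) \<longlonglongrightarrow> 0"
    using t(1) by (simp add: less_imp_neq[THEN not_sym] abs_of_pos)
  then have "a = 0"
    by (simp add: LIMSEQ_const_iff)
  moreover have "(\<lambda>k. infdist (z + t k *\<^sub>R b) K) \<in> o(t)"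
    by (rule smallo_mono[OF o infdist_nonneg infdist_le_infdist_zero_times[OF assms]])
  ultimately show "d \<in> {0} \<times> tangent_cone K z"
    using t by (auto simp: d tangent_cone_def)
next
  fix d :: "'a \<times> 'b"
  assume "d \<in> {0} \<times> tangent_cone K z"
  then show "d \<in> tangent_cone ({0} \<times> K) (0, z)"
    by (auto simp: tangent_cone_def infdist_zero_times_zero[OF assms])
qed

lemma second_tangent_set_zero_times:
  fixes z d :: "'b::euclidean_space"
  assumes "K \<noteq> {}"
  shows "second_tangent_set ({0::'a::euclidean_space} \<times> K) (0, z) (0, d) = {0} \<times> second_tangent_set K z d"
proof (intro set_eqI iffI)
  fix w :: "'a \<times> 'b"
  assume "w \<in> second_tangent_set ({0} \<times> K) (0, z) (0, d)"
  then obtain a b t where w: "w = (a, b)" and t: "\<forall>k. 0 < t k" "t \<longlonglongrightarrow> 0"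
    and o: "(\<lambda>k. infdist (((t k)\<^sup>2 / 2) *\<^sub>R a, z + t k *\<^sub>R d + ((t k)\<^sup>2 / 2) *\<^sub>R b) ({0} \<times> K)) \<in> o(\<lambda>k. (t k)\<^sup>2)"
    by (cases w) (auto simp: second_tangent_set_def)
  have "(\<lambda>k. norm (((t k)\<^sup>2 / 2) *\<^sub>R a)) \<in> o(\<lambda>k. (t k)\<^sup>2)"
    by (rule smallo_mono[OF o norm_ge_zero norm_le_infdist_zero_times[OF assms]])
  \<comment> \<open>Here division by \<open>t^2\<close> leaves \<open>norm a / 2\<close>, from the
    factor in the second-order term.\<close>
  from smalloD_tendsto[OF this] have "(\<lambda>k::nat. norm a / 2) \<longlonglongrightarrow> 0"
    using t(1) by (simp add: less_imp_neq[THEN not_sym])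
  then have "a = 0"
    by (simp add: LIMSEQ_const_iff)
  moreover have "(\<lambda>k. infdist (z + t k *\<^sub>R d + ((t k)\<^sup>2 / 2) *\<^sub>R b) K) \<in> o(\<lambda>k. (t k)\<^sup>2)"
    by (rule smallo_mono[OF o infdist_nonneg infdist_le_infdist_zero_times[OF assms]])
  ultimately show "w \<in> {0} \<times> second_tangent_set K z d"
    using t by (auto simp: w second_tangent_set_def)
next
  fix w :: "'a \<times> 'b"
  assume "w \<in> {0} \<times> second_tangent_set K z d"
  then show "w \<in> second_tangent_set ({0} \<times> K) (0, z) (0, d)"
    by (auto simp: second_tangent_set_def infdist_zero_times_zero[OF assms])
qed

section \<open>Reflection and product rules; lineality spaces and tangency tests\<close>

lemma infdist_uminus: "infdist (- x) (uminus ` K) = infdist x (K :: 'a::euclidean_space set)"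
  by (simp add: infdist_def image_image dist_minus)

lemma tangent_cone_uminus:
  "tangent_cone (uminus ` K) (- z) = uminus ` tangent_cone K (z :: 'a::euclidean_space)"
proof -
  have "infdist (- z + t *\<^sub>R d) (uminus ` K) = infdist (z + t *\<^sub>R (- d)) K" for t d
    using infdist_uminus[of "z + t *\<^sub>R (- d)" K] by simp
  then have "d \<in> tangent_cone (uminus ` K) (- z) \<longleftrightarrow> - d \<in> tangent_cone K z" for d
    by (simp add: tangent_cone_def)
  then show ?thesis
    by (force intro: image_eqI[of _ _ "- x" for x])
qed

lemma second_tangent_set_uminus:
  "second_tangent_set (uminus ` K) (- z) (- d) = uminus ` second_tangent_set K (z :: 'a::euclidean_space) d"
proof -
  have "infdist (- z + t *\<^sub>R (- d) + s *\<^sub>R w) (uminus ` K) = infdist (z + t *\<^sub>R d + s *\<^sub>R (- w)) K" for t s w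
    using infdist_uminus[of "z + t *\<^sub>R d + s *\<^sub>R (- w)" K] by (simp add: algebra_simps)
  then have "w \<in> second_tangent_set (uminus ` K) (- z) (- d) \<longleftrightarrow> - w \<in> second_tangent_set K z d" for w
    by (simp add: second_tangent_set_def)
  then show ?thesis
    by (force intro: image_eqI[of _ _ "- x" for x])
qed

lemma normal_cone_uminus:
  "- y \<in> normal_cone (uminus ` K) (- z) \<longleftrightarrow> y \<in> normal_cone K z"
  by (auto simp: normal_cone_def image_iff inner_diff_right)

lemma orth_compl_of_uminus: "uminus ` orth_compl_of y = orth_compl_of (- y)"
  by (force simp: orth_compl_of_def intro: image_eqI[of _ _ "- x" for x])

lemma normal_cone_zero_times:
  "(\<xi>, y) \<in> normal_cone ({0} \<times> K) (a, z) \<longleftrightarrow> a = 0 \<and> y \<in> normal_cone K z"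
  by (auto simp: normal_cone_def)

lemma orth_compl_of_zero_times:
  "({0} \<times> T) \<inter> orth_compl_of (\<xi>, y) = {0} \<times> (T \<inter> orth_compl_of y)"
  by (auto simp: orth_compl_of_def)

lemma support_fun_zero_times:
  "support_fun (\<xi>, y) ({0::'a::euclidean_space} \<times> S) = support_fun y S"
proof -
  have "{0::'a} \<times> S = Pair 0 ` S" by auto
  then show ?thesis by (simp add: support_fun_def image_image)
qed

lemma support_fun_uminus: "support_fun (- y) (uminus ` S) = support_fun y S"
  by (simp add: support_fun_def image_image)

text \<open>A subspace inside \<open>C\<close> contains \<open>- d\<close> along with
  \<open>d\<close>, so the last hypothesis traps every competitor in \<open>S\<close>.\<close>

lemma lineality_eqI:
  assumes "subspace S" "S \<subseteq> C" "\<And>d. d \<in> C \<Longrightarrow> - d \<in> C \<Longrightarrow> d \<in> S"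
  shows "lineality C = S"
  unfolding lineality_def
  using assms subspace_neg by (intro Greatest_equality) blast+

text \<open>First-order necessary condition: \<open>m\<close> is minimized over \<open>K\<close> at
  \<open>z\<close>, and the point of \<open>K\<close> nearest to \<open>z + t d\<close> differs from
  it by only \<open>o(t)\<close>.\<close>

lemma tangent_cone_inner_nonneg:
  fixes K :: "'a::euclidean_space set"
  assumes "closed K" "z \<in> K" and d: "d \<in> tangent_cone K z" and m: "\<And>k. k \<in> K \<Longrightarrow> m \<bullet> z \<le> m \<bullet> k"
  shows "0 \<le> m \<bullet> d"
proof -
  obtain t where t: "\<forall>k. 0 < t k" "t \<longlonglongrightarrow> 0"
    and o: "(\<lambda>k. infdist (z + t k *\<^sub>R d) K) \<in> o(t)"
    using d by (auto simp: tangent_cone_def)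
  have "- norm m * (infdist (z + t k *\<^sub>R d) K / t k) \<le> m \<bullet> d" for k
  proof -
    obtain s where s: "s \<in> K" "infdist (z + t k *\<^sub>R d) K = dist (z + t k *\<^sub>R d) s"
      using infdist_attains_inf[OF assms(1)] assms(2) by blast
    have "m \<bullet> (s - (z + t k *\<^sub>R d)) \<le> norm m * infdist (z + t k *\<^sub>R d) K"
      using norm_cauchy_schwarz[of m "s - (z + t k *\<^sub>R d)"]
      by (simp add: s dist_norm norm_minus_commute)
    then have "- norm m * infdist (z + t k *\<^sub>R d) K \<le> t k * (m \<bullet> d)"
      using m[OF s(1)] by (simp add: inner_diff_right inner_add_right)
    then show ?thesis
      using t(1)[rule_format, of k] by (simp add: field_simps)
  qed
  moreover have "(\<lambda>k. - norm m * (infdist (z + t k *\<^sub>R d) K / t k)) \<longlonglongrightarrow> - norm m * 0"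
    by (intro tendsto_mult tendsto_const smalloD_tendsto[OF o])
  ultimately show ?thesis
    by (intro LIMSEQ_le_const2[of _ "- norm m * 0", simplified]) auto
qed

text \<open>Along \<open>t k = 1 / (k + 1)\<close> the second-order distance is zero, and the
  first-order distance is at most the size of the quadratic term.\<close>

lemma parabola_tangent:
  fixes K :: "'a::euclidean_space set"
  assumes "\<And>t::real. 0 < t \<Longrightarrow> z + t *\<^sub>R d + (t\<^sup>2 / 2) *\<^sub>R w \<in> K"
  shows parabola_in_tangent_cone: "d \<in> tangent_cone K z"
    and parabola_in_second_tangent_set: "w \<in> second_tangent_set K z d"
proof -
  define t :: "nat \<Rightarrow> real" where "t k = 1 / real (Suc k)" for k
  have t: "\<forall>k. 0 < t k" and lim: "t \<longlonglongrightarrow> 0"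
    using LIMSEQ_inverse_real_of_nat by (simp_all add: t_def[abs_def] inverse_eq_divide)
  have "(\<lambda>k. (t k)\<^sup>2 / 2 * norm w) \<in> o(t)"
  proof (rule smalloI_tendsto)
    have "(\<lambda>k. t k * (norm w / 2)) \<longlonglongrightarrow> 0 * (norm w / 2)"
      by (intro tendsto_mult lim tendsto_const)
    then show "(\<lambda>k. (t k)\<^sup>2 / 2 * norm w / t k) \<longlonglongrightarrow> 0"
      using t by (simp add: power2_eq_square less_imp_neq[THEN not_sym] mult_ac)
    show "\<forall>\<^sub>F k in sequentially. t k \<noteq> 0"
      using t by (simp add: less_imp_neq[THEN not_sym])
  qed
  then have "(\<lambda>k. infdist (z + t k *\<^sub>R d) K) \<in> o(t)"
  proof (rule smallo_mono[OF _ infdist_nonneg])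
    fix k
    show "infdist (z + t k *\<^sub>R d) K \<le> (t k)\<^sup>2 / 2 * norm w"
      using assms[OF t[rule_format, of k]] by (rule infdist_le2) (simp add: dist_norm)
  qed
  with t lim show "d \<in> tangent_cone K z"
    by (auto simp: tangent_cone_def)
  have "infdist (z + t k *\<^sub>R d + ((t k)\<^sup>2 / 2) *\<^sub>R w) K = 0" for k
    using assms[OF t[rule_format, of k]] by simp
  with t lim show "w \<in> second_tangent_set K z d"
    by (auto simp: second_tangent_set_def intro!: exI[of _ t])
qed

section \<open>Critical cones of complementary matrices\<close>

text \<open>The signs are those of a primal constraint value and its multiplier. For them a zero
  product amounts to a zero inner product; the product is the form needed to cancel terms in matrix
  expressions.\<close>

definition complementary :: "real^'n^'n \<Rightarrow> real^'n^'n \<Rightarrow> bool" where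
  "complementary Z Y \<longleftrightarrow> Z \<in> psd_cone \<and> - Y \<in> psd_cone \<and> Z ** Y = 0"

lemma complementaryD:
  assumes "complementary Z Y"
  shows "Z \<in> psd_cone" "- Y \<in> psd_cone" "Z \<in> sym_mats" "Y \<in> sym_mats" "transpose Z = Z"
    "transpose Y = Y" "Z ** Y = 0" "Y ** Z = 0" "Y \<bullet> Z = 0"
proof -
  show Z: "Z \<in> psd_cone" and Y: "- Y \<in> psd_cone" and ZY: "Z ** Y = 0"
    using assms by (auto simp: complementary_def)
  show *: "Z \<in> sym_mats" "Y \<in> sym_mats"
    using psd_cone_sym[OF Z] psd_cone_sym[OF Y] subspace_neg[OF subspace_sym_mats, of "- Y"] by auto
  then show t: "transpose Z = Z" "transpose Y = Y"
    by (simp_all add: sym_mats_def)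
  show YZ: "Y ** Z = 0"
    using arg_cong[OF ZY, of transpose] by (simp add: matrix_transpose_mul t)
  show "Y \<bullet> Z = 0"
    by (simp add: inner_eq_trace t YZ trace_def)
qed

lemma complementary_swap:
  assumes "complementary Z Y"
  shows "complementary (- Y) (- Z)"
  using complementaryD(1,2,8)[OF assms]
  by (simp add: complementary_def matrix_mult_algebra)

text \<open>Testing a normal vector at \<open>0\<close> and \<open>2 Z\<close> gives
  \<open>Y \<bullet> Z = 0\<close>, and testing at outer squares gives the sign of \<open>Y\<close>.
  The zero pairing then upgrades to a zero product.\<close>

lemma normal_cone_psd:
  assumes "Y \<in> sym_mats"
  shows "Y \<in> normal_cone psd_cone Z \<longleftrightarrow> complementary Z Y"
proof
  assume "Y \<in> normal_cone psd_cone Z"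
  then have Z: "Z \<in> psd_cone" and n: "\<And>k. k \<in> psd_cone \<Longrightarrow> Y \<bullet> (k - Z) \<le> 0"
    by (auto simp: normal_cone_def split: if_splits)
  have YZ: "Y \<bullet> Z = 0"
    using n[of 0] n[OF psd_cone_scale[OF Z, of 2]] by (simp add: inner_diff_right)
  have "u \<bullet> ((- Y) *v u) \<ge> 0" for u
    using n[OF outer_square_psd[of u]] YZ
    by (simp add: inner_diff_right inner_outer_square[symmetric])
  then have Y: "- Y \<in> psd_cone"
    using subspace_neg[OF subspace_sym_mats assms] by (simp add: psd_cone_def)
  have "Z ** (- Y) = 0"
    using YZ by (intro psd_inner_zero_imp_mult_zero Y Z) simp
  with Z Y show "complementary Z Y"
    by (simp add: complementary_def matrix_mult_algebra)
next
  assume c: "complementary Z Y"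
  have "Y \<bullet> (k - Z) \<le> 0" if "k \<in> psd_cone" for k
    using psd_inner_nonneg[OF complementaryD(2)[OF c] that] complementaryD(9)[OF c]
    by (simp add: inner_diff_right)
  then show "Y \<in> normal_cone psd_cone Z"
    using complementaryD[OF c] by (simp add: normal_cone_def)
qed

lemma normal_cone_nsd:
  assumes "Y \<in> sym_mats"
  shows "Y \<in> normal_cone nsd_cone Z \<longleftrightarrow> complementary Y Z"
  using normal_cone_uminus[of "- Y" psd_cone "- Z"] normal_cone_psd[of "- Y" "- Z"]
    subspace_neg[OF subspace_sym_mats assms] complementary_swap[of Y Z] complementary_swap[of "- Z" "- Y"]
  by (auto simp: uminus_psd_cone)

lemma tangent_cone_psd_sym:
  assumes "Z \<in> psd_cone" "D \<in> tangent_cone psd_cone Z"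
  shows "D \<in> sym_mats"
proof -
  \<comment> \<open>A skew matrix pairs to zero with the whole cone, so the first-order test
    applies; yet its pairing with \<open>D\<close> is minus half its squared norm.\<close>
  let ?m = "transpose D - D"
  have "0 \<le> ?m \<bullet> D"
  proof (rule tangent_cone_inner_nonneg[OF closed_psd_cone assms])
    have *: "?m \<bullet> k = 0" if "k \<in> psd_cone" for k
      using psd_cone_sym[OF that] by (simp add: inner_diff_left inner_transpose_left sym_mats_def)
    show "?m \<bullet> Z \<le> ?m \<bullet> k" if "k \<in> psd_cone" for k
      using *[OF that] *[OF assms(1)] by simp
  qed
  moreover have "?m \<bullet> ?m = - 2 * (?m \<bullet> D)"
    by (simp add: inner_diff_left inner_diff_right inner_transpose inner_transpose_left[symmetric]
        inner_commute[of D "transpose D"])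
  ultimately have "?m \<bullet> ?m \<le> 0" by simp
  then have "?m = 0"
    by (metis inner_eq_zero_iff inner_ge_zero order_antisym)
  then show ?thesis by (simp add: sym_mats_def)
qed

text \<open>Pairing with the outer square of \<open>u\<close> is nonnegative on the cone and zero at
  \<open>Z\<close>, hence nonnegative on tangent directions.\<close>

lemma tangent_cone_psd_form:
  assumes "Z \<in> psd_cone" "D \<in> tangent_cone psd_cone Z" "Z *v u = 0"
  shows "0 \<le> u \<bullet> (D *v u)"
proof -
  have "0 \<le> outer_square u \<bullet> D"
    by (rule tangent_cone_inner_nonneg[OF closed_psd_cone assms(1,2)])
       (simp add: inner_commute[of "outer_square u"] inner_outer_square assms(3) psd_cone_form)
  then show ?thesis
    by (simp add: inner_commute[of "outer_square u"] inner_outer_square)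
qed

text \<open>The parabola is \<open>(I + t B)\<^sup>T Z (I + t B)\<close>, which stays in the cone for every \<open>t\<close>.\<close>

lemma psd_cone_parabola:
  fixes Z B :: "real^'n^'n"
  assumes Z: "Z \<in> psd_cone"
  shows "Z + t *\<^sub>R (Z ** B + transpose B ** Z) + (t\<^sup>2 / 2) *\<^sub>R (2 *\<^sub>R (transpose B ** Z ** B)) \<in> psd_cone"
proof -
  have "transpose (mat 1 + t *\<^sub>R B) ** Z ** (mat 1 + t *\<^sub>R B) \<in> psd_cone"
    by (rule psd_cone_congruence[OF Z])
  also have "transpose (mat 1 + t *\<^sub>R B) ** Z ** (mat 1 + t *\<^sub>R B) =
    Z + t *\<^sub>R (Z ** B + transpose B ** Z) + (t\<^sup>2 / 2) *\<^sub>R (2 *\<^sub>R (transpose B ** Z ** B))"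
    by (simp add: matrix_mult_algebra transpose_mat algebra_simps power2_eq_square)
  finally show ?thesis .
qed

lemma inner_mult_zero:
  fixes Y Z M :: "real^'n^'n"
  assumes "transpose Y = Y" "Y ** Z = 0"
  shows "Y \<bullet> (Z ** M) = 0" "Y \<bullet> (M ** transpose Z) = 0"
proof -
  show *: "Y \<bullet> (Z ** M) = 0" for M
    using inner_matrix_mult_left[of Z M Y] arg_cong[OF assms(2), of transpose]
    by (simp add: inner_commute matrix_transpose_mul assms(1))
  show "Y \<bullet> (M ** transpose Z) = 0"
    using inner_transpose_left[of Y "M ** transpose Z"] * by (simp add: assms(1) matrix_transpose_mul)
qed

text \<open>Such a \<open>D\<close> is the velocity of a congruence parabola inside the cone, and
  \<open>Y\<close> annihilates both terms of its decomposition because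
  \<open>Y ** Z = 0\<close>.\<close>

lemma vanishing_on_kernel_in_critical_cone:
  assumes c: "complementary Z Y"
  shows "vanishing_on_kernel Z \<subseteq> tangent_cone psd_cone Z \<inter> orth_compl_of Y"
proof
  fix D assume "D \<in> vanishing_on_kernel Z"
  then obtain B where D: "D = Z ** B + transpose B ** Z"
    using vanishing_on_kernel_decomp complementaryD(3)[OF c] by metis
  have "D \<in> tangent_cone psd_cone Z"
    unfolding D by (rule parabola_in_tangent_cone[OF psd_cone_parabola[OF complementaryD(1)[OF c]]])
  moreover have "Y \<bullet> D = 0"
    using inner_mult_zero[OF complementaryD(6,8)[OF c]]
    by (simp add: D inner_add_right complementaryD(5)[OF c])
  ultimately show "D \<in> tangent_cone psd_cone Z \<inter> orth_compl_of Y"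
    by (simp add: orth_compl_of_def inner_commute)
qed

text \<open>Together with the preceding inclusion this identifies the lineality space of the
  critical cone; orthogonality to the multiplier then comes for free.\<close>

lemma tangent_cone_psd_lines:
  assumes Z: "Z \<in> psd_cone"
    and "D \<in> tangent_cone psd_cone Z" "- D \<in> tangent_cone psd_cone Z"
  shows "D \<in> vanishing_on_kernel Z"
proof -
  have "u \<bullet> ((- D) *v u) = - (u \<bullet> (D *v u))" for u
    by (simp add: inner_outer_square[symmetric])
  then have "u \<bullet> (D *v u) = 0" if "Z *v u = 0" for u
    using tangent_cone_psd_form[OF Z assms(2) that]
      tangent_cone_psd_form[OF Z assms(3) that] by simp
  then show ?thesis
    using tangent_cone_psd_sym[OF Z assms(2)]
    by (simp add: vanishing_on_kernel_def)
qed

section \<open>The sigma term of the second order condition\<close>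

text \<open>The multiplier is moved along the curve \<open>(I - t B) Y (I - t B)\<^sup>T\<close>, which cancels the first-order
  term of \<open>Z + t D\<close>; pairing with the nearest matrix of the cone then bounds the second-order term.\<close>

lemma second_tangent_set_psd_le:
  fixes Z Y B :: "real^'n^'n"
  assumes c: "complementary Z Y"
    and w: "w \<in> second_tangent_set psd_cone Z (Z ** B + transpose B ** Z)"
  shows "Y \<bullet> w \<le> 2 * (Y \<bullet> (transpose B ** Z ** B))"
proof -
  note cD = complementaryD[OF c]
  define D where "D = Z ** B + transpose B ** Z"
  define g where "g = Y \<bullet> (transpose B ** Z ** B)"
  \<comment> \<open>\<open>- M\<close> and \<open>N\<close> are the coefficients of order one and
    two in the curve of multipliers.\<close>
  define M where "M = B ** Y + Y ** transpose B"
  define N where "N = B ** Y ** transpose B"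
  have YD: "Y \<bullet> D = 0"
    using inner_mult_zero[OF cD(6,8)] by (simp add: D_def inner_add_right cD(5))
  have MZ: "M \<bullet> Z = 0"
    by (simp add: M_def inner_add_left inner_matrix_mult_left[of Y] inner_matrix_mult_right[of B Y] cD)
  have NZ: "N \<bullet> Z = g"
    using inner_matrix_mult_right[of "B ** Y" "transpose B" Z] inner_matrix_mult_left[of B Y "Z ** B"]
    by (simp add: N_def g_def matrix_mul_assoc)
  have BYD: "(B ** Y) \<bullet> D = g"
    using inner_mult_zero[OF cD(6,8), of "transpose B ** B"]
    using inner_mult_zero(2)[OF cD(6,8), of "transpose B ** transpose B"]
    by (simp add: D_def g_def inner_add_right inner_matrix_mult_left[of B] matrix_mult_algebra
        matrix_mul_assoc cD)
  have "transpose D = D"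
    by (simp add: D_def matrix_transpose_mul cD add.commute)
  then have "(Y ** transpose B) \<bullet> D = g"
    using inner_transpose[of "B ** Y" D] by (simp add: BYD matrix_transpose_mul cD)
  then have MD: "M \<bullet> D = 2 * g"
    by (simp add: M_def inner_add_left BYD)
  obtain t where t: "\<forall>k. 0 < t k" "t \<longlonglongrightarrow> 0"
    and o: "(\<lambda>k. infdist (Z + t k *\<^sub>R D + ((t k)\<^sup>2 / 2) *\<^sub>R w) psd_cone) \<in> o(\<lambda>k. (t k)\<^sup>2)"
    using w by (auto simp: second_tangent_set_def D_def)
  define Yt where "Yt r = Y - r *\<^sub>R M + r\<^sup>2 *\<^sub>R N" for r
  have Yt: "- Yt r \<in> psd_cone" for r
  proof -
    \<comment> \<open>The double transpose brings the congruence by \<open>(I - r B)\<close> from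
      the left into the shape \<open>A^T M A\<close>.\<close>
    have "transpose (transpose (mat 1 - r *\<^sub>R B)) ** (- Y) ** transpose (mat 1 - r *\<^sub>R B) \<in> psd_cone"
      by (rule psd_cone_congruence[OF cD(2)])
    also have "transpose (transpose (mat 1 - r *\<^sub>R B)) ** (- Y) ** transpose (mat 1 - r *\<^sub>R B) = - Yt r"
      by (simp add: Yt_def M_def N_def matrix_mult_algebra transpose_mat algebra_simps power2_eq_square)
    finally show ?thesis .
  qed
  define X where "X k = Z + t k *\<^sub>R D + ((t k)\<^sup>2 / 2) *\<^sub>R w" for k
  \<comment> \<open>The pairing of \<open>Yt\<close> with \<open>X\<close>, divided by
    \<open>t^2\<close>: the orders zero and one cancel, and in the constant term
    \<open>- M \<bullet> D = - 2 g\<close> meets \<open>N \<bullet> Z = g\<close>.\<close>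
  define p where "p r = Y \<bullet> w / 2 - g + r * (N \<bullet> D - M \<bullet> w / 2) + r\<^sup>2 * (N \<bullet> w / 2)" for r
  have "p (t k) \<le> norm (Yt (t k)) * (infdist (X k) psd_cone / (t k)\<^sup>2)" for k
  proof -
    obtain S where S: "S \<in> psd_cone" "infdist (X k) psd_cone = dist (X k) S"
      using infdist_attains_inf[OF closed_psd_cone] zero_in_psd_cone by blast
    have "Yt (t k) \<bullet> S \<le> 0"
      using psd_inner_nonneg[OF Yt S(1)] by simp
    then have "Yt (t k) \<bullet> X k \<le> Yt (t k) \<bullet> (X k - S)"
      by (simp add: inner_diff_right)
    also have "\<dots> \<le> norm (Yt (t k)) * infdist (X k) psd_cone"
      by (simp add: S(2) dist_norm norm_cauchy_schwarz)
    also have "Yt (t k) \<bullet> X k = (t k)\<^sup>2 * p (t k)"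
      by (simp add: Yt_def X_def p_def inner_add_left inner_add_right inner_diff_left
          YD MZ NZ MD cD) (simp add: field_simps power2_eq_square)
    finally show ?thesis
      using t(1)[rule_format, of k] by (simp add: field_simps)
  qed
  moreover have "(\<lambda>k. p (t k)) \<longlonglongrightarrow> Y \<bullet> w / 2 - g + 0 * (N \<bullet> D - M \<bullet> w / 2) + 0\<^sup>2 * (N \<bullet> w / 2)"
    unfolding p_def by (intro tendsto_intros t(2))
  moreover have "(\<lambda>k. norm (Yt (t k)) * (infdist (X k) psd_cone / (t k)\<^sup>2)) \<longlonglongrightarrow>
      norm (Y - 0 *\<^sub>R M + 0\<^sup>2 *\<^sub>R N) * 0"
    unfolding Yt_def
    by (intro tendsto_mult[OF _ smalloD_tendsto[OF o, folded X_def]] tendsto_intros t(2))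
  ultimately have "Y \<bullet> w / 2 - g + 0 * (N \<bullet> D - M \<bullet> w / 2) + 0\<^sup>2 * (N \<bullet> w / 2)
      \<le> norm (Y - 0 *\<^sub>R M + 0\<^sup>2 *\<^sub>R N) * 0"
    by (intro LIMSEQ_le[of "\<lambda>k. p (t k)"]) auto
  then show ?thesis by (simp add: g_def)
qed

text \<open>The upper bound is attained at the quadratic coefficient \<open>2 V\<close> of the
  congruence parabola, so the supremum is a real number. If it is zero, then
  \<open>V ** Y = 0\<close>, so the form of \<open>Z\<close> vanishes on the range of
  \<open>B ** Y\<close>; hence \<open>Z ** B ** Y = 0\<close>, and this product is
  \<open>D ** Y\<close>.\<close>

lemma support_fun_second_tangent_set_psd:
  fixes Z Y D :: "real^'n^'n"
  assumes c: "complementary Z Y" and "D \<in> vanishing_on_kernel Z"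
  obtains r where "support_fun Y (second_tangent_set psd_cone Z D) = ereal r"
    "r \<le> 0" "r = 0 \<longleftrightarrow> D ** Y = 0"
proof -
  note cD = complementaryD[OF c]
  obtain B where D: "D = Z ** B + transpose B ** Z"
    using vanishing_on_kernel_decomp[OF cD(3) assms(2)] by metis
  define V where "V = transpose B ** Z ** B"
  have V: "V \<in> psd_cone"
    unfolding V_def by (rule psd_cone_congruence[OF cD(1)])
  have "support_fun Y (second_tangent_set psd_cone Z D) = ereal (2 * (Y \<bullet> V))"
    unfolding support_fun_def
  proof (intro order_antisym SUP_least)
    fix w assume "w \<in> second_tangent_set psd_cone Z D"
    then show "ereal (Y \<bullet> w) \<le> ereal (2 * (Y \<bullet> V))"
      using second_tangent_set_psd_le[OF c] by (simp add: D V_def)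
  next
    have "2 *\<^sub>R V \<in> second_tangent_set psd_cone Z D"
      unfolding D V_def by (rule parabola_in_second_tangent_set[OF psd_cone_parabola[OF cD(1)]])
    then show "ereal (2 * (Y \<bullet> V)) \<le> (SUP w\<in>second_tangent_set psd_cone Z D. ereal (Y \<bullet> w))"
      by (intro SUP_upper2[of "2 *\<^sub>R V"]) simp_all
  qed
  moreover have "2 * (Y \<bullet> V) \<le> 0"
    using psd_inner_nonneg[OF cD(2) V] by simp
  moreover have DY: "D ** Y = Z ** B ** Y"
    by (simp add: D matrix_mult_algebra cD flip: matrix_mul_assoc)
  have "2 * (Y \<bullet> V) = 0 \<longleftrightarrow> D ** Y = 0"
  proof
    assume "2 * (Y \<bullet> V) = 0"
    then have "V ** Y = 0"
      using psd_inner_zero_imp_mult_zero[OF cD(2) V] by (simp add: matrix_mult_algebra)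
    then have "V *v (Y *v u) = 0" for u
      by (simp add: matrix_vector_mul_assoc)
    then have "(B *v (Y *v u)) \<bullet> (Z *v (B *v (Y *v u))) = 0" for u
      using quadratic_form_congruence[of "Y *v u" B Z] by (simp add: V_def)
    then have "Z *v (B *v (Y *v u)) = 0" for u
      using psd_form_zero_imp[OF cD(1)] by blast
    then show "D ** Y = 0"
      by (simp add: DY matrix_eq flip: matrix_vector_mul_assoc)
  next
    assume "D ** Y = 0"
    then have "Z ** B ** Y = 0" by (simp add: DY)
    then have "V ** Y = 0"
      unfolding V_def by (metis matrix_mul_assoc matrix_mult_zero(2))
    then have "trace (V ** Y) = 0" by (simp add: trace_def)
    then show "2 * (Y \<bullet> V) = 0"
      using psd_cone_sym[OF V] by (simp add: inner_eq_trace[of V] inner_commute[of Y] sym_mats_def)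
  qed
  ultimately show ?thesis using that by blast
qed

section \<open>Orthogonal complement of the critical cone\<close>

lemma outer_square_in_critical_cone:
  assumes c: "complementary Z Y" and "Y *v v = 0"
  shows "outer_square v \<in> tangent_cone psd_cone Z \<inter> orth_compl_of Y"
proof -
  have "outer_square v \<in> tangent_cone psd_cone Z"
    by (rule parabola_in_tangent_cone[where w = 0])
       (simp add: psd_cone_add psd_cone_scale outer_square_psd complementaryD(1)[OF c])
  moreover have "Y \<bullet> outer_square v = 0"
    by (simp add: inner_outer_square assms)
  ultimately show ?thesis
    by (simp add: orth_compl_of_def inner_commute)
qed

text \<open>Necessity comes from two families of test directions: outer squares from the kernel of
  \<open>Y\<close>, and directions in the lineality space. For sufficiency, a critical
  \<open>D\<close> compressed to the kernel of \<open>Z\<close> is semidefinite and orthogonal to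
  \<open>Y\<close>, so its product with \<open>Y\<close> vanishes; this cancels both terms of the
  decomposition of \<open>V\<close>.\<close>

lemma critical_cone_psd_orthogonal:
  fixes Z Y V :: "real^'n^'n"
  assumes c: "complementary Z Y" and V: "V \<in> sym_mats"
  shows "(\<forall>D \<in> tangent_cone psd_cone Z \<inter> orth_compl_of Y. V \<bullet> D = 0) \<longleftrightarrow>
    V ** Z = 0 \<and> V \<in> vanishing_on_kernel Y"
proof
  note cD = complementaryD[OF c]
  have tV: "transpose V = V" using V by (simp add: sym_mats_def)
  {
    assume a: "\<forall>D \<in> tangent_cone psd_cone Z \<inter> orth_compl_of Y. V \<bullet> D = 0"
    have "V \<in> vanishing_on_kernel Y"
      using a outer_square_in_critical_cone[OF c] V
      by (auto simp: vanishing_on_kernel_def inner_outer_square[symmetric])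
    moreover have "V ** Z = 0"
    proof -
      \<comment> \<open>Chosen so that the lineality direction
        \<open>Z ** B + transpose B ** Z\<close> pairs with \<open>V\<close> to
        \<open>2 |Z V|^2\<close>.\<close>
      define B where "B = Z ** V"
      have "Z ** B + transpose B ** Z \<in> tangent_cone psd_cone Z \<inter> orth_compl_of Y"
      proof (rule subsetD[OF vanishing_on_kernel_in_critical_cone[OF c]])
        have "u \<bullet> ((Z ** B + transpose B ** Z) *v u) = 0" if "Z *v u = 0" for u
          using that sym_mats_inner[OF cD(3), of u "B *v u"]
          by (simp add: matrix_vector_mult_add_rdistrib inner_add_right flip: matrix_vector_mul_assoc)
        then show "Z ** B + transpose B ** Z \<in> vanishing_on_kernel Z"
          by (simp add: vanishing_on_kernel_def sym_mats_def matrix_transpose_mul cD add.commute)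
      qed
      from bspec[OF a this] have "V \<bullet> (Z ** B) + V \<bullet> (transpose B ** Z) = 0"
        by (simp only: inner_add_right)
      moreover have "V \<bullet> (transpose B ** Z) = V \<bullet> (Z ** B)"
        using inner_transpose[of V "Z ** B"] by (simp add: tV matrix_transpose_mul cD)
      ultimately have "V \<bullet> (Z ** B) = 0" by simp
      then have "B \<bullet> B = 0"
        using inner_matrix_mult_left[of Z B V] by (simp add: cD B_def inner_commute)
      then have "Z ** V = 0" by (simp add: B_def)
      from arg_cong[OF this, of transpose] show ?thesis
        by (simp add: matrix_transpose_mul tV cD)
    qed
    ultimately show "V ** Z = 0 \<and> V \<in> vanishing_on_kernel Y" by blast
  }
  assume a: "V ** Z = 0 \<and> V \<in> vanishing_on_kernel Y"
  obtain B where VB: "V = Y ** B + transpose B ** Y"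
    using a vanishing_on_kernel_decomp[OF cD(4)] by metis
  obtain P A where P: "P = Z ** A" "P = transpose A ** Z" "transpose P = P" "Z ** P = Z"
    using sym_range_projection[OF cD(3)] by metis
  define F where "F = mat 1 - P"
  have tF: "transpose F = F"
    by (simp add: F_def P(3) transpose_mat)
  have YF: "Y ** F = Y"
    by (simp add: F_def matrix_mult_algebra P(1) matrix_mul_assoc cD)
  have FY: "F ** Y = Y"
    using arg_cong[OF YF, of transpose] by (simp add: matrix_transpose_mul tF cD)
  \<comment> \<open>This is \<open>V ** Z = 0\<close> after dropping the term with
    \<open>Y ** Z\<close>. It lets the kernel projection \<open>F\<close> be inserted to the right
    of \<open>Y ** B\<close>.\<close>
  have "Y ** B ** Z = 0"
    using a by (simp add: VB matrix_mult_algebra cD flip: matrix_mul_assoc)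
  then have YBF: "Y ** B ** F = Y ** B"
    by (simp add: F_def matrix_mult_algebra P(1) matrix_mul_assoc)
  show "\<forall>D \<in> tangent_cone psd_cone Z \<inter> orth_compl_of Y. V \<bullet> D = 0"
  proof
    fix D assume "D \<in> tangent_cone psd_cone Z \<inter> orth_compl_of Y"
    then have D: "D \<in> tangent_cone psd_cone Z" and YD: "Y \<bullet> D = 0"
      by (auto simp: orth_compl_of_def inner_commute)
    have tD: "transpose D = D"
      using tangent_cone_psd_sym[OF cD(1) D] by (simp add: sym_mats_def)
    have ZF: "Z *v (F *v u) = 0" for u
      by (simp add: F_def matrix_vector_mul_assoc matrix_mult_algebra P(4))
    have "u \<bullet> ((F ** D ** F) *v u) \<ge> 0" for u
      using quadratic_form_congruence[of u F D] tangent_cone_psd_form[OF cD(1) D ZF, of u] by (simp add: tF)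
    then have E: "F ** D ** F \<in> psd_cone"
      by (simp add: psd_cone_def sym_mats_def matrix_transpose_mul tF tD matrix_mul_assoc)
    \<comment> \<open>Since \<open>F ** Y = Y = Y ** F\<close>, compressing \<open>D\<close> does
      not change its pairing with \<open>Y\<close>.\<close>
    have "Y \<bullet> (F ** D ** F) = 0"
      using inner_matrix_mult_left[of F "D ** F" Y] inner_matrix_mult_right[of D F Y]
      by (simp add: tF FY YF YD inner_commute[of _ Y] matrix_mul_assoc)
    then have "F ** D ** F ** Y = 0"
      using psd_inner_zero_imp_mult_zero[OF cD(2) E] by (simp add: matrix_mult_algebra)
    then have FDY: "F ** D ** Y = 0"
      by (metis FY matrix_mul_assoc)
    have YDF: "Y ** D ** F = 0"
      using arg_cong[OF FDY, of transpose] by (simp add: matrix_transpose_mul tF tD cD matrix_mul_assoc)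
    have "(Y ** B) \<bullet> D = (Y ** B ** F) \<bullet> D" by (simp add: YBF)
    also have "\<dots> = B \<bullet> (Y ** D ** F)"
      by (simp add: inner_matrix_mult_right[of "Y ** B"] inner_matrix_mult_left[of Y] tF cD matrix_mul_assoc)
    finally have 1: "(Y ** B) \<bullet> D = 0" by (simp add: YDF)
    have "(transpose B ** Y) \<bullet> D = (Y ** B) \<bullet> D"
      using inner_transpose[of "Y ** B" D] by (simp add: matrix_transpose_mul cD tD)
    then show "V \<bullet> D = 0"
      by (simp add: VB inner_add_left 1)
  qed
qed

section \<open>Transfer to the negative semidefinite cone\<close>

lemma vanishing_on_kernel_uminus: "vanishing_on_kernel (- Z) = vanishing_on_kernel Z"
  by (simp add: vanishing_on_kernel_def uminus_matrix_vector_mult)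

text \<open>Reflects the base point, the multiplier and the direction together;
  \<open>complementary_swap\<close> supplies the matching hypothesis in the transfers below.\<close>

lemma critical_cone_nsd:
  "tangent_cone nsd_cone Z \<inter> orth_compl_of Y =
    uminus ` (tangent_cone psd_cone (- Z) \<inter> orth_compl_of (- Y))"
  using tangent_cone_uminus[of psd_cone "- Z"] orth_compl_of_uminus[of "- Y"]
  by (simp add: uminus_psd_cone image_Int)

lemma vanishing_on_kernel_in_critical_cone_nsd:
  assumes "complementary Y Z"
  shows "vanishing_on_kernel Z \<subseteq> tangent_cone nsd_cone Z \<inter> orth_compl_of Y"
proof
  fix D assume "D \<in> vanishing_on_kernel Z"
  then have "- D \<in> vanishing_on_kernel (- Z)"
    by (simp add: vanishing_on_kernel_uminus subspace_neg[OF subspace_vanishing_on_kernel])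
  then have "- D \<in> tangent_cone psd_cone (- Z) \<inter> orth_compl_of (- Y)"
    using vanishing_on_kernel_in_critical_cone[OF complementary_swap[OF assms]] by blast
  then show "D \<in> tangent_cone nsd_cone Z \<inter> orth_compl_of Y"
    unfolding critical_cone_nsd by (rule image_eqI[rotated]) simp
qed

lemma tangent_cone_nsd_lines:
  assumes "- Z \<in> psd_cone"
    and "D \<in> tangent_cone nsd_cone Z" "- D \<in> tangent_cone nsd_cone Z"
  shows "D \<in> vanishing_on_kernel Z"
proof -
  have "tangent_cone nsd_cone Z = uminus ` tangent_cone psd_cone (- Z)"
    using tangent_cone_uminus[of psd_cone "- Z"] by (simp add: uminus_psd_cone)
  then show ?thesis
    using tangent_cone_psd_lines[OF assms(1), of D] assms(2,3)
    by (auto simp: vanishing_on_kernel_uminus)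
qed

lemma support_fun_second_tangent_set_nsd:
  fixes Z Y D :: "real^'n^'n"
  assumes c: "complementary Y Z" and D: "D \<in> vanishing_on_kernel Z"
  obtains r where "support_fun Y (second_tangent_set nsd_cone Z D) = ereal r"
    "r \<le> 0" "r = 0 \<longleftrightarrow> D ** Y = 0"
proof -
  have "- D \<in> vanishing_on_kernel (- Z)"
    using D by (simp add: vanishing_on_kernel_uminus subspace_neg[OF subspace_vanishing_on_kernel])
  then obtain r where r: "support_fun (- Y) (second_tangent_set psd_cone (- Z) (- D)) = ereal r"
    "r \<le> 0" "r = 0 \<longleftrightarrow> (- D) ** (- Y) = 0"
    using support_fun_second_tangent_set_psd[OF complementary_swap[OF c]] by metis
  moreover have "second_tangent_set nsd_cone Z D = uminus ` second_tangent_set psd_cone (- Z) (- D)"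
    using second_tangent_set_uminus[of psd_cone "- Z" "- D"] by (simp add: uminus_psd_cone)
  ultimately show ?thesis
    using that support_fun_uminus[of "- Y"] by (simp add: matrix_mult_algebra)
qed

lemma critical_cone_nsd_orthogonal:
  fixes Z Y V :: "real^'n^'n"
  assumes c: "complementary Y Z" and V: "V \<in> sym_mats"
  shows "(\<forall>D \<in> tangent_cone nsd_cone Z \<inter> orth_compl_of Y. V \<bullet> D = 0) \<longleftrightarrow>
    V ** Z = 0 \<and> V \<in> vanishing_on_kernel Y"
  using critical_cone_psd_orthogonal[OF complementary_swap[OF c] V]
  by (simp add: critical_cone_nsd vanishing_on_kernel_uminus matrix_mult_algebra del: image_Int)

section \<open>Calculus on subspaces\<close>

text \<open>The line \<open>u + t h\<close> stays in \<open>U\<close>, so uniqueness reduces to that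
  of an ordinary derivative in one real variable.\<close>

lemma has_derivative_within_subspace_unique:
  fixes f :: "'a::euclidean_space \<Rightarrow> 'b::real_normed_vector"
  assumes U: "subspace U" "u \<in> U" "h \<in> U"
    and f: "(f has_derivative f1) (at u within U)" "(f has_derivative f2) (at u within U)"
  shows "f1 h = f2 h"
proof -
  define l where "l t = u + t *\<^sub>R h" for t :: real
  have l: "(l has_derivative (\<lambda>t. t *\<^sub>R h)) (at 0)"
    unfolding l_def by (auto intro!: derivative_eq_intros)
  have "range l \<subseteq> U"
    using U by (auto simp: l_def subspace_add subspace_scale)
  then have *: "((\<lambda>t. f (l t)) has_derivative (\<lambda>t. f' (t *\<^sub>R h))) (at 0)"
    if "(f has_derivative f') (at u within U)" for f'
    using has_derivative_in_compose[OF l, of f f'] has_derivative_subset[OF that]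
    by (simp add: l_def)
  have "(\<lambda>t. f1 (t *\<^sub>R h)) = (\<lambda>t. f2 (t *\<^sub>R h))"
    by (rule has_derivative_unique[OF *[OF f(1)] *[OF f(2)]])
  from fun_cong[OF this, of 1] show ?thesis by simp
qed

lemma frechet_derivative_within_subspace:
  fixes f :: "'a::euclidean_space \<Rightarrow> 'b::real_normed_vector"
  assumes "subspace U" "u \<in> U" "h \<in> U" and f: "(f has_derivative f') (at u within U)"
  shows "frechet_derivative f (at u within U) h = f' h"
proof (rule has_derivative_within_subspace_unique[OF assms(1-3) _ f])
  show "(f has_derivative frechet_derivative f (at u within U)) (at u within U)"
    using f frechet_derivative_works differentiable_def by blast
qed

lemma gradient_on_eqI:
  assumes "subspace U" "u \<in> U" "g \<in> U" and f: "(f has_derivative (\<lambda>h. g \<bullet> h)) (at u within U)"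
  shows "gradient_on U f u = g"
  unfolding gradient_on_def
proof (rule the_equality)
  show "g \<in> U \<and> (f has_derivative (\<lambda>h. g \<bullet> h)) (at u within U)"
    using assms by simp
next
  fix g' assume g': "g' \<in> U \<and> (f has_derivative (\<lambda>h. g' \<bullet> h)) (at u within U)"
  \<comment> \<open>The difference of two candidates is itself an admissible direction, and testing
    on it makes its norm zero.\<close>
  then have "g' - g \<in> U"
    using assms by (simp add: subspace_diff)
  then have "g' \<bullet> (g' - g) = g \<bullet> (g' - g)"
    using has_derivative_within_subspace_unique[OF assms(1,2) _ _ f] g' by blast
  then have "(g' - g) \<bullet> (g' - g) = 0"
    by (simp add: inner_diff_left)
  then show "g' = g" by simp
qed

lemma hessian_on_eqI:
  assumes "subspace U" "u \<in> U" "d \<in> U"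
    and "\<And>v. v \<in> U \<Longrightarrow> gradient_on U f v = g v"
    and "(g has_derivative g') (at u within U)"
  shows "hessian_on U f u d = g' d"
  unfolding hessian_on_def
  using assms by (intro frechet_derivative_within_subspace)
    (auto intro: has_derivative_transform)

text \<open>Orthogonal decomposition: the residual of a vector of \<open>Y\<close> against
  \<open>span A\<close> stays in \<open>Y\<close> and is orthogonal to \<open>A\<close>. This is how
  W-SRCQ turns into a uniqueness statement comparable with W-SOC.\<close>

lemma span_eq_subspace_iff_orthogonal:
  fixes A :: "'a::euclidean_space set"
  assumes "subspace Y" "A \<subseteq> Y"
  shows "span A = Y \<longleftrightarrow> (\<forall>v\<in>Y. (\<forall>a\<in>A. a \<bullet> v = 0) \<longrightarrow> v = 0)"
proof
  assume Y: "span A = Y"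
  show "\<forall>v\<in>Y. (\<forall>a\<in>A. a \<bullet> v = 0) \<longrightarrow> v = 0"
  proof (intro ballI impI)
    fix v assume "v \<in> Y" "\<forall>a\<in>A. a \<bullet> v = 0"
    then have "orthogonal v v"
      using orthogonal_to_span[of v A v] Y by (simp add: orthogonal_def inner_commute)
    then show "v = 0" by (simp add: orthogonal_def)
  qed
next
  assume o: "\<forall>v\<in>Y. (\<forall>a\<in>A. a \<bullet> v = 0) \<longrightarrow> v = 0"
  have sub: "span A \<subseteq> Y"
    by (rule span_minimal[OF assms(2,1)])
  moreover have "x \<in> span A" if "x \<in> Y" for x
  proof -
    obtain y z where y: "y \<in> span A" and z: "\<And>w. w \<in> span A \<Longrightarrow> orthogonal z w" and x: "x = y + z"
      using orthogonal_subspace_decomp_exists[where S = A and x = x] by metis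
    have "z \<in> Y"
      using subspace_diff[OF assms(1) that, of y] y sub by (auto simp: x)
    then have "z = 0"
      using o z by (auto simp: orthogonal_def inner_commute span_base)
    then show ?thesis using x y by simp
  qed
  ultimately show "span A = Y" by blast
qed

section \<open>W-SRCQ and W-SOC by orthogonality\<close>

text \<open>\<open>L\<close> extends the derivative, which is determined only along the variable
  space, to a linear map. Its image is a subspace, so the sum in W-SRCQ is the span of a union and
  the orthogonality criterion applies.\<close>

lemma W_SRCQ_iff:
  assumes "kkt_point P u y"
    and "subspace (var_space P)" "subspace (con_space P)"
    and "linear L" "\<And>d. d \<in> var_space P \<Longrightarrow> con_deriv P u d = L d"
    and "L ` var_space P \<subseteq> con_space P"
    and "tangent_cone (con_set P) (con_map P u) \<inter> orth_compl_of y = C" "C \<subseteq> con_space P"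
  shows "W_SRCQ P u y \<longleftrightarrow>
    (\<forall>v \<in> con_space P. (\<forall>d \<in> var_space P. L d \<bullet> v = 0) \<longrightarrow> (\<forall>s \<in> C. s \<bullet> v = 0) \<longrightarrow> v = 0)"
proof -
  have img: "con_deriv P u ` var_space P = L ` var_space P"
    using assms(5) by (intro image_cong) auto
  have sp: "span (L ` var_space P) = L ` var_space P"
    by (simp add: span_eq_iff linear_subspace_image[OF assms(4,2)])
  have "W_SRCQ P u y \<longleftrightarrow> span (L ` var_space P \<union> C) = con_space P"
    using assms(1) by (simp add: W_SRCQ_def img assms(7) span_Un sp)
  also have "\<dots> \<longleftrightarrow> (\<forall>v \<in> con_space P. (\<forall>a \<in> L ` var_space P \<union> C. a \<bullet> v = 0) \<longrightarrow> v = 0)"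
    using assms(6,8) by (intro span_eq_subspace_iff_orthogonal[OF assms(3)]) auto
  finally show ?thesis
    by (auto simp: ball_Un)
qed

text \<open>Both the curvature \<open>h d\<close> and minus the sigma term are nonnegative, so
  strict positivity fails exactly when both vanish. The cone \<open>K\<close> is left abstract to
  cover both problems.\<close>

lemma W_SOC_iff:
  fixes P :: "('u::euclidean_space, 'a::euclidean_space \<times> (real^'n^'n)) program"
  assumes "kkt_point P u (\<eta>, Y)"
    and K: "con_set P = {0} \<times> K" "K \<noteq> {}" and "con_map P u = (0, Z)"
    and V: "vanishing_on_kernel Z \<subseteq> tangent_cone K Z \<inter> orth_compl_of Y"
      "\<And>D. D \<in> tangent_cone K Z \<Longrightarrow> - D \<in> tangent_cone K Z \<Longrightarrow> D \<in> vanishing_on_kernel Z"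
    and r: "\<And>D. D \<in> vanishing_on_kernel Z \<Longrightarrow>
      \<exists>r. support_fun Y (second_tangent_set K Z D) = ereal r \<and> r \<le> 0 \<and> (r = 0 \<longleftrightarrow> D ** Y = 0)"
    and "\<And>d. d \<in> var_space P \<Longrightarrow> con_deriv P u d = (A d, B d)"
    and "\<And>d. d \<in> var_space P \<Longrightarrow> d \<bullet> hessian_on (var_space P) (\<lambda>v. lagrangian P v (\<eta>, Y)) u d = h d"
    and "\<And>d. 0 \<le> h d"
  shows "W_SOC P u (\<eta>, Y) \<longleftrightarrow>
    (\<forall>d \<in> var_space P. A d = 0 \<longrightarrow> B d \<in> vanishing_on_kernel Z \<longrightarrow> B d ** Y = 0 \<longrightarrow> h d = 0 \<longrightarrow> d = 0)"
proof -
  have lin: "lineality (tangent_cone (con_set P) (con_map P u) \<inter> orth_compl_of (\<eta>, Y)) =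
      {0} \<times> vanishing_on_kernel Z"
    unfolding K(1) assms(4) tangent_cone_zero_times[OF K(2)] orth_compl_of_zero_times
  proof (rule lineality_eqI)
    show "subspace ({0::'a} \<times> vanishing_on_kernel Z)"
      by (intro subspace_Times subspace_single_0 subspace_vanishing_on_kernel)
  qed (use V in auto)
  have pos: "ereal (h d) - support_fun (\<eta>, Y) (second_tangent_set (con_set P) (con_map P u) (0, D)) > 0
      \<longleftrightarrow> \<not> (D ** Y = 0 \<and> h d = 0)" if D: "D \<in> vanishing_on_kernel Z" for D d
  proof -
    obtain r where "support_fun Y (second_tangent_set K Z D) = ereal r" "r \<le> 0" "r = 0 \<longleftrightarrow> D ** Y = 0"
      using r[OF D] by blast
    then show ?thesis
      using assms(10)[of d]
      by (auto simp: K(1) assms(4) second_tangent_set_zero_times[OF K(2)] support_fun_zero_times)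
  qed
  show ?thesis
    unfolding W_SOC_def lin
    using assms(1,8,9) pos by (auto simp: mem_Times_iff)
qed

lemma uminus_diffs_eq_0_iff:
  fixes a :: "'a::ab_group_add"
  shows "- a - b - e = 0 \<longleftrightarrow> a + b + e = 0" "- a - b - d = e \<longleftrightarrow> a + b + d + e = 0"
proof -
  have "- a - b - e = - (a + b + e)" "- a - b - d = - (a + b + d + e) + e"
    by (simp_all add: algebra_simps)
  then show "- a - b - e = 0 \<longleftrightarrow> a + b + e = 0" "- a - b - d = e \<longleftrightarrow> a + b + d + e = 0"
    by (simp_all only: neg_equal_0_iff_equal add_eq_self_zero add_cancel_left_left add_cancel_right_left)
qed

section \<open>The primal problem: derivatives, KKT points and both conditions\<close>

context
  fixes Q :: "'x::euclidean_space \<Rightarrow> 'x" and c :: 'x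
    and H :: "'x \<Rightarrow> real^'m" and p :: "real^'m"
    and G :: "'x \<Rightarrow> real^'n^'n" and q :: "real^'n^'n"
  assumes Q: "linear Q" "\<And>x y. Q x \<bullet> y = x \<bullet> Q y" "\<And>x. 0 \<le> x \<bullet> Q x"
    and H: "linear H"
    and G: "linear G" "range G \<subseteq> sym_mats" and q: "q \<in> sym_mats"
begin

abbreviation (input) "primal \<equiv> qsdp_primal Q c H p G q"
abbreviation (input) "dual W \<equiv> qsdp_dual W Q c H p G q"

lemma bounded_linear_qsdp:
  "bounded_linear Q" "bounded_linear H" "bounded_linear G"
  "bounded_linear (adjoint H)" "bounded_linear (adjoint G)"
  using Q H G adjoint_linear by (auto simp: linear_conv_bounded_linear)

lemmas linear_qsdp =
  bounded_linear_qsdp[THEN bounded_linear.linear, THEN linear_add]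
  bounded_linear_qsdp[THEN bounded_linear.linear, THEN linear_scale]

lemmas has_derivative_qsdp = bounded_linear_qsdp[THEN bounded_linear.has_derivative]

lemma con_deriv_primal: "con_deriv primal x d = (H d, G d)"
  unfolding con_deriv_def qsdp_primal_def
  by (intro frechet_derivative_within_subspace)
     (auto intro!: derivative_eq_intros has_derivative_qsdp)

lemma gradient_primal:
  "gradient_on UNIV (\<lambda>v. lagrangian primal v (\<xi>, \<Gamma>)) x = Q x + c + adjoint H \<xi> + adjoint G \<Gamma>"
  unfolding lagrangian_def
proof (rule gradient_on_eqI)
  show "((\<lambda>v. objective (primal) v + (\<xi>, \<Gamma>) \<bullet> con_map (primal) v) has_derivative
      (\<lambda>h. (Q x + c + adjoint H \<xi> + adjoint G \<Gamma>) \<bullet> h)) (at x)"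
    unfolding qsdp_primal_def
    by (auto intro!: derivative_eq_intros has_derivative_qsdp
       simp: fun_eq_iff inner_add_left inner_add_right Q(2) inner_commute
         adjoint_works[OF H] adjoint_works[OF G(1)] field_simps)
       (metis Q(2) inner_commute)
qed auto

lemma hessian_primal:
  "hessian_on UNIV (\<lambda>v. lagrangian primal v (\<xi>, \<Gamma>)) x d = Q d"
  by (rule hessian_on_eqI[OF _ _ _ gradient_primal])
     (auto intro!: derivative_eq_intros has_derivative_qsdp)

lemma kkt_point_primal_iff:
  "kkt_point primal x (\<xi>, \<Gamma>) \<longleftrightarrow>
    \<Gamma> \<in> sym_mats \<and> Q x + c + adjoint H \<xi> + adjoint G \<Gamma> = 0 \<and> H x = p \<and> complementary (G x - q) \<Gamma>"
  using gradient_primal[of \<xi> \<Gamma> x] normal_cone_psd[of \<Gamma> "G x - q"]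
  by (auto simp: kkt_point_def qsdp_primal_def normal_cone_zero_times)

lemma qsdp_form_zero_iff: "d \<bullet> Q d = 0 \<longleftrightarrow> Q d = 0"
  using self_adjoint_psd_form_zero_imp[of Q d] Q by auto

lemma W_SOC_primal_iff:
  assumes kkt: "kkt_point primal x (\<xi>, \<Gamma>)"
  shows "W_SOC primal x (\<xi>, \<Gamma>) \<longleftrightarrow>
    (\<forall>d. H d = 0 \<longrightarrow> G d \<in> vanishing_on_kernel (G x - q) \<longrightarrow> G d ** \<Gamma> = 0 \<longrightarrow> Q d = 0 \<longrightarrow> d = 0)"
proof -
  have k: "H x = p" and c: "complementary (G x - q) \<Gamma>"
    using kkt by (auto simp: kkt_point_primal_iff)
  have "W_SOC primal x (\<xi>, \<Gamma>) \<longleftrightarrow>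
    (\<forall>d \<in> var_space primal. H d = 0 \<longrightarrow> G d \<in> vanishing_on_kernel (G x - q) \<longrightarrow> G d ** \<Gamma> = 0 \<longrightarrow>
      d \<bullet> Q d = 0 \<longrightarrow> d = 0)"
  proof (rule W_SOC_iff[OF kkt, where K = psd_cone])
    show "\<exists>r. support_fun \<Gamma> (second_tangent_set psd_cone (G x - q) D) = ereal r \<and> r \<le> 0 \<and> (r = 0 \<longleftrightarrow> D ** \<Gamma> = 0)"
      if "D \<in> vanishing_on_kernel (G x - q)" for D
      using support_fun_second_tangent_set_psd[OF c that] by metis
    show "con_set primal = {0} \<times> psd_cone" "con_map primal x = (0, G x - q)"
      by (simp_all add: qsdp_primal_def k)
    show "psd_cone \<noteq> ({} :: (real^'n^'n) set)" using zero_in_psd_cone by blast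
    show "vanishing_on_kernel (G x - q) \<subseteq> tangent_cone psd_cone (G x - q) \<inter> orth_compl_of \<Gamma>"
      by (rule vanishing_on_kernel_in_critical_cone[OF c])
    show "D \<in> vanishing_on_kernel (G x - q)"
      if "D \<in> tangent_cone psd_cone (G x - q)" "- D \<in> tangent_cone psd_cone (G x - q)" for D
      by (rule tangent_cone_psd_lines[OF complementaryD(1)[OF c] that])
    show "d \<bullet> hessian_on (var_space primal) (\<lambda>v. lagrangian primal v (\<xi>, \<Gamma>)) x d = d \<bullet> Q d" for d
      using hessian_primal by (simp add: qsdp_primal_def)
  qed (simp_all add: con_deriv_primal Q(3))
  then show ?thesis
    by (simp add: qsdp_form_zero_iff qsdp_primal_def)
qed

text \<open>Orthogonality to the image of \<open>(H, G)\<close> is a kernel condition on the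
  adjoints; orthogonality to the critical cone is the matrix criterion for \<open>V\<close>, while
  \<open>\<eta>\<close> meets only the zero factor.\<close>

lemma W_SRCQ_primal_iff:
  assumes kkt: "kkt_point primal x (\<xi>, \<Gamma>)"
  shows "W_SRCQ primal x (\<xi>, \<Gamma>) \<longleftrightarrow>
    (\<forall>\<eta>. \<forall>V \<in> sym_mats. adjoint H \<eta> + adjoint G V = 0 \<longrightarrow> V ** (G x - q) = 0 \<longrightarrow>
      V \<in> vanishing_on_kernel \<Gamma> \<longrightarrow> \<eta> = 0 \<and> V = 0)"
proof -
  define L where "L = (\<lambda>d. (H d, G d))"
  define C where "C = {0::real^'m} \<times> (tangent_cone psd_cone (G x - q) \<inter> orth_compl_of \<Gamma>)"
  have k: "H x = p" and c: "complementary (G x - q) \<Gamma>"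
    using kkt by (auto simp: kkt_point_primal_iff)
  have ne: "psd_cone \<noteq> ({} :: (real^'n^'n) set)" using zero_in_psd_cone by blast
  have inner_L: "L d \<bullet> (\<eta>, V) = d \<bullet> (adjoint H \<eta> + adjoint G V)" for d \<eta> V
    by (simp add: L_def inner_add_right adjoint_works[OF H] adjoint_works[OF G(1)])
  have L0: "(\<forall>d. L d \<bullet> (\<eta>, V) = 0) \<longleftrightarrow> adjoint H \<eta> + adjoint G V = 0" for \<eta> V
    unfolding inner_L by (metis inner_eq_zero_iff inner_zero_right)
  have C: "C \<subseteq> UNIV \<times> sym_mats"
    using tangent_cone_psd_sym[OF complementaryD(1)[OF c]] by (auto simp: C_def)
  have orth: "(\<forall>s \<in> C. s \<bullet> (\<eta>, V) = 0) \<longleftrightarrow> V ** (G x - q) = 0 \<and> V \<in> vanishing_on_kernel \<Gamma>"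
    if "V \<in> sym_mats" for \<eta> V
    using critical_cone_psd_orthogonal[OF c that] by (auto simp: C_def inner_commute[of V])
  have "W_SRCQ primal x (\<xi>, \<Gamma>) \<longleftrightarrow>
    (\<forall>v \<in> con_space primal. (\<forall>d \<in> var_space primal. L d \<bullet> v = 0) \<longrightarrow> (\<forall>s \<in> C. s \<bullet> v = 0) \<longrightarrow> v = 0)"
  proof (rule W_SRCQ_iff[OF kkt])
    show "linear L"
      unfolding L_def by (rule linearI) (simp_all add: linear_qsdp algebra_simps)
    show "tangent_cone (con_set primal) (con_map primal x) \<inter> orth_compl_of (\<xi>, \<Gamma>) = C"
      by (simp add: C_def qsdp_primal_def k tangent_cone_zero_times[OF ne] orth_compl_of_zero_times)
    show "con_deriv primal x d = L d" for d
      by (simp add: con_deriv_primal L_def)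
  qed (use C G(2) in \<open>auto simp: qsdp_primal_def L_def subspace_Times subspace_sym_mats\<close>)
  also have "\<dots> \<longleftrightarrow> (\<forall>\<eta>. \<forall>V \<in> sym_mats. (\<forall>d. L d \<bullet> (\<eta>, V) = 0) \<longrightarrow> (\<forall>s \<in> C. s \<bullet> (\<eta>, V) = 0) \<longrightarrow> \<eta> = 0 \<and> V = 0)"
    by (auto simp: qsdp_primal_def zero_prod_def)
  finally show ?thesis
    by (simp add: L0 orth imp_conjL cong: ball_cong)
qed

section \<open>The dual problem over a subspace containing the range of \<open>Q\<close>\<close>

context
  fixes W :: "'x set"
  assumes W: "subspace W" "range Q \<subseteq> W"
begin

lemma subspace_dual_space: "subspace (W \<times> (UNIV :: (real^'m) set) \<times> (sym_mats :: (real^'n^'n) set))"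
  by (intro subspace_Times W subspace_UNIV subspace_sym_mats)

lemma con_deriv_dual:
  assumes "w \<in> W \<times> UNIV \<times> sym_mats" "d \<in> W \<times> UNIV \<times> sym_mats"
  shows "con_deriv (dual W) w d =
    (- Q (fst d) - adjoint H (fst (snd d)) - adjoint G (snd (snd d)), snd (snd d))"
  unfolding con_deriv_def qsdp_dual_def case_prod_unfold
  using assms subspace_dual_space
  by (intro frechet_derivative_within_subspace)
     (auto intro!: derivative_eq_intros has_derivative_qsdp simp del: mem_Times_iff)

text \<open>Since \<open>W\<close> contains the range of \<open>Q\<close>, the component
  \<open>Q \<omega> - Q x\<close> already lies in \<open>W\<close>, so no projection onto
  \<open>W\<close> appears.\<close>

lemma gradient_dual:
  assumes "\<Upsilon> \<in> sym_mats" "w \<in> W \<times> UNIV \<times> sym_mats"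
  shows "gradient_on (W \<times> UNIV \<times> sym_mats) (\<lambda>v. lagrangian (dual W) v (x, \<Upsilon>)) w =
    (Q (fst w) - Q x, p - H x, q - G x + \<Upsilon>)"
proof (rule gradient_on_eqI[OF subspace_dual_space assms(2)])
  show "(Q (fst w) - Q x, p - H x, q - G x + \<Upsilon>) \<in> W \<times> UNIV \<times> sym_mats"
    using W G(2) q assms(1)
    by (auto intro!: subspace_add subspace_diff subspace_sym_mats)
  show "((\<lambda>v. lagrangian (dual W) v (x, \<Upsilon>)) has_derivative
      (\<lambda>h. (Q (fst w) - Q x, p - H x, q - G x + \<Upsilon>) \<bullet> h)) (at w within W \<times> UNIV \<times> sym_mats)"
    unfolding lagrangian_def qsdp_dual_def case_prod_unfold
    by (auto intro!: derivative_eq_intros has_derivative_qsdp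
       simp: fun_eq_iff inner_add_left inner_add_right inner_diff_left inner_diff_right Q(2)
         adjoint_works[OF H] adjoint_works[OF G(1)] field_simps)
       (metis Q(2) inner_commute)
qed

lemma hessian_dual:
  assumes "\<Upsilon> \<in> sym_mats" "w \<in> W \<times> UNIV \<times> sym_mats" "d \<in> W \<times> UNIV \<times> sym_mats"
  shows "hessian_on (W \<times> UNIV \<times> sym_mats) (\<lambda>v. lagrangian (dual W) v (x, \<Upsilon>)) w d = (Q (fst d), 0, 0)"
  by (rule hessian_on_eqI[OF subspace_dual_space assms(2,3) gradient_dual[OF assms(1)]])
     (auto intro!: derivative_eq_intros has_derivative_qsdp simp: zero_prod_def)

lemma kkt_point_dual_iff:
  "kkt_point (dual W) (\<omega>, \<xi>, \<Gamma>) (x, \<Upsilon>) \<longleftrightarrow>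
    \<omega> \<in> W \<and> \<Gamma> \<in> sym_mats \<and> \<Upsilon> \<in> sym_mats \<and> Q \<omega> = Q x \<and> H x = p \<and> \<Upsilon> = G x - q \<and>
    Q \<omega> + c + adjoint H \<xi> + adjoint G \<Gamma> = 0 \<and> complementary \<Upsilon> \<Gamma>"
proof -
  have "q - G x + \<Upsilon> = 0 \<longleftrightarrow> \<Upsilon> = G x - q"
    by (auto simp: algebra_simps)
  then show ?thesis
    using gradient_dual[of \<Upsilon> "(\<omega>, \<xi>, \<Gamma>)" x] normal_cone_nsd[of \<Upsilon> \<Gamma>]
    by (auto simp: kkt_point_def qsdp_dual_def normal_cone_zero_times zero_prod_def uminus_diffs_eq_0_iff)
qed

lemma W_SOC_dual_iff:
  assumes kkt: "kkt_point (dual W) (\<omega>, \<xi>, \<Gamma>) (x, \<Upsilon>)"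
  shows "W_SOC (dual W) (\<omega>, \<xi>, \<Gamma>) (x, \<Upsilon>) \<longleftrightarrow>
    (\<forall>a \<in> W. \<forall>\<eta>. \<forall>V \<in> sym_mats. Q a + adjoint H \<eta> + adjoint G V = 0 \<longrightarrow> V \<in> vanishing_on_kernel \<Gamma> \<longrightarrow>
      V ** \<Upsilon> = 0 \<longrightarrow> Q a = 0 \<longrightarrow> a = 0 \<and> \<eta> = 0 \<and> V = 0)"
proof -
  have k: "\<omega> \<in> W" "\<Gamma> \<in> sym_mats" "\<Upsilon> \<in> sym_mats" "Q \<omega> + c + adjoint H \<xi> + adjoint G \<Gamma> = 0"
    and c: "complementary \<Upsilon> \<Gamma>"
    using kkt by (auto simp: kkt_point_dual_iff)
  have "W_SOC (dual W) (\<omega>, \<xi>, \<Gamma>) (x, \<Upsilon>) \<longleftrightarrow>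
    (\<forall>d \<in> var_space (dual W). - Q (fst d) - adjoint H (fst (snd d)) - adjoint G (snd (snd d)) = 0 \<longrightarrow>
      snd (snd d) \<in> vanishing_on_kernel \<Gamma> \<longrightarrow> snd (snd d) ** \<Upsilon> = 0 \<longrightarrow> fst d \<bullet> Q (fst d) = 0 \<longrightarrow> d = 0)"
  proof (rule W_SOC_iff[OF kkt, where K = nsd_cone])
    show "con_map (dual W) (\<omega>, \<xi>, \<Gamma>) = (0, \<Gamma>)"
      using k(4) by (simp add: qsdp_dual_def uminus_diffs_eq_0_iff)
    show "\<exists>r. support_fun \<Upsilon> (second_tangent_set nsd_cone \<Gamma> D) = ereal r \<and> r \<le> 0 \<and> (r = 0 \<longleftrightarrow> D ** \<Upsilon> = 0)"
      if "D \<in> vanishing_on_kernel \<Gamma>" for D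
      using support_fun_second_tangent_set_nsd[OF c that] by metis
    show "con_set (dual W) = {0} \<times> nsd_cone" by (simp add: qsdp_dual_def)
    show "nsd_cone \<noteq> ({} :: (real^'n^'n) set)" using zero_in_psd_cone uminus_psd_cone by blast
    show "vanishing_on_kernel \<Gamma> \<subseteq> tangent_cone nsd_cone \<Gamma> \<inter> orth_compl_of \<Upsilon>"
      by (rule vanishing_on_kernel_in_critical_cone_nsd[OF c])
    show "D \<in> vanishing_on_kernel \<Gamma>" if "D \<in> tangent_cone nsd_cone \<Gamma>" "- D \<in> tangent_cone nsd_cone \<Gamma>" for D
      by (rule tangent_cone_nsd_lines[OF complementaryD(2)[OF c] that])
    fix d assume "d \<in> var_space (dual W)"
    then have d: "d \<in> W \<times> UNIV \<times> sym_mats" and w: "(\<omega>, \<xi>, \<Gamma>) \<in> W \<times> UNIV \<times> sym_mats"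
      using k by (simp_all add: qsdp_dual_def)
    show "con_deriv (dual W) (\<omega>, \<xi>, \<Gamma>) d =
        (- Q (fst d) - adjoint H (fst (snd d)) - adjoint G (snd (snd d)), snd (snd d))"
      by (rule con_deriv_dual[OF w d])
    show "d \<bullet> hessian_on (var_space (dual W)) (\<lambda>v. lagrangian (dual W) v (x, \<Upsilon>)) (\<omega>, \<xi>, \<Gamma>) d =
        fst d \<bullet> Q (fst d)"
      using hessian_dual[OF k(3) w d, of x] by (simp add: qsdp_dual_def inner_prod_def)
  qed (rule Q(3))
  also have "\<dots> \<longleftrightarrow> (\<forall>a \<in> W. \<forall>\<eta>. \<forall>V \<in> sym_mats. Q a + adjoint H \<eta> + adjoint G V = 0 \<longrightarrow> V \<in> vanishing_on_kernel \<Gamma> \<longrightarrow>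
      V ** \<Upsilon> = 0 \<longrightarrow> Q a = 0 \<longrightarrow> a = 0 \<and> \<eta> = 0 \<and> V = 0)"
    unfolding qsdp_form_zero_iff uminus_diffs_eq_0_iff by (auto simp: qsdp_dual_def zero_prod_def)
  finally show ?thesis .
qed

text \<open>A direction \<open>V\<close> enters both components of the derivative, as
  \<open>- adjoint G V\<close> and as \<open>V\<close>. Orthogonality of \<open>(d, U)\<close> to
  the image therefore forces \<open>U = G d\<close>, and only \<open>d\<close> remains free.\<close>

lemma W_SRCQ_dual_iff:
  assumes kkt: "kkt_point (dual W) (\<omega>, \<xi>, \<Gamma>) (x, \<Upsilon>)"
  shows "W_SRCQ (dual W) (\<omega>, \<xi>, \<Gamma>) (x, \<Upsilon>) \<longleftrightarrow>
    (\<forall>d. (\<forall>a \<in> W. a \<bullet> Q d = 0) \<longrightarrow> H d = 0 \<longrightarrow> G d ** \<Gamma> = 0 \<longrightarrow> G d \<in> vanishing_on_kernel \<Upsilon> \<longrightarrow> d = 0)"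
proof -
  define L where "L = (\<lambda>d. (- Q (fst d) - adjoint H (fst (snd d)) - adjoint G (snd (snd d)), snd (snd d)))"
  define C where "C = {0::'x} \<times> (tangent_cone nsd_cone \<Gamma> \<inter> orth_compl_of \<Upsilon>)"
  have k: "\<omega> \<in> W" "\<Gamma> \<in> sym_mats" "\<Upsilon> \<in> sym_mats" "Q \<omega> + c + adjoint H \<xi> + adjoint G \<Gamma> = 0"
    and c: "complementary \<Upsilon> \<Gamma>"
    using kkt by (auto simp: kkt_point_dual_iff)
  have ne: "nsd_cone \<noteq> ({} :: (real^'n^'n) set)" using zero_in_psd_cone uminus_psd_cone by blast
  have Gd: "G d \<in> sym_mats" for d using G(2) by auto
  have inner_L: "L (a, \<eta>, V) \<bullet> (d, U) = - (a \<bullet> Q d) - \<eta> \<bullet> H d - V \<bullet> (G d - U)" for a \<eta> V d U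
    by (simp add: L_def inner_diff_left inner_diff_right Q(2)
       inner_commute[of "adjoint H \<eta>"] inner_commute[of "adjoint G V"]
       adjoint_works[OF H] adjoint_works[OF G(1)] inner_commute[of \<eta>] inner_commute[of V])
  have L0: "(\<forall>w \<in> W \<times> UNIV \<times> sym_mats. L w \<bullet> (d, U) = 0) \<longleftrightarrow> (\<forall>a \<in> W. a \<bullet> Q d = 0) \<and> H d = 0 \<and> U = G d"
    if "U \<in> sym_mats" for d U
  proof
    assume l: "\<forall>w \<in> W \<times> UNIV \<times> sym_mats. L w \<bullet> (d, U) = 0"
    \<comment> \<open>The test directions \<open>(a, 0, 0)\<close>, \<open>(0, H d, 0)\<close> and
      \<open>(0, 0, G d - U)\<close> isolate the three terms of \<open>inner_L\<close>.\<close>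
    have "a \<bullet> Q d = 0" if "a \<in> W" for a
      using l[rule_format, of "(a, 0, 0)"] inner_L[of a 0 0 d U] that by (simp add: subspace_0[OF subspace_sym_mats])
    moreover have "H d \<bullet> H d = 0"
      using l[rule_format, of "(0, H d, 0)"] inner_L[of 0 "H d" 0 d U] by (simp add: subspace_0[OF subspace_sym_mats] subspace_0[OF W(1)])
    moreover have "(G d - U) \<bullet> (G d - U) = 0"
      using l[rule_format, of "(0, 0, G d - U)"] inner_L[of 0 0 "G d - U" d U] subspace_diff[OF subspace_sym_mats Gd that] by (simp add: subspace_0[OF W(1)])
    ultimately show "(\<forall>a \<in> W. a \<bullet> Q d = 0) \<and> H d = 0 \<and> U = G d" by simp
  qed (auto simp: inner_L)
  have "tangent_cone nsd_cone \<Gamma> \<inter> orth_compl_of \<Upsilon> \<subseteq> sym_mats"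
    using tangent_cone_psd_sym[OF complementaryD(1)[OF complementary_swap[OF c]]]
    unfolding critical_cone_nsd by (auto intro!: subspace_neg[OF subspace_sym_mats])
  then have C: "C \<subseteq> UNIV \<times> sym_mats"
    by (auto simp: C_def)
  have orth: "(\<forall>s \<in> C. s \<bullet> (d, U) = 0) \<longleftrightarrow> U ** \<Gamma> = 0 \<and> U \<in> vanishing_on_kernel \<Upsilon>"
    if "U \<in> sym_mats" for d U
    using critical_cone_nsd_orthogonal[OF c that] by (auto simp: C_def inner_commute[of U])
  have "W_SRCQ (dual W) (\<omega>, \<xi>, \<Gamma>) (x, \<Upsilon>) \<longleftrightarrow>
    (\<forall>v \<in> con_space (dual W). (\<forall>d \<in> var_space (dual W). L d \<bullet> v = 0) \<longrightarrow> (\<forall>s \<in> C. s \<bullet> v = 0) \<longrightarrow> v = 0)"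
  proof (rule W_SRCQ_iff[OF kkt])
    show "linear L"
      unfolding L_def by (rule linearI) (simp_all add: linear_qsdp algebra_simps)
    have "con_map (dual W) (\<omega>, \<xi>, \<Gamma>) = (0, \<Gamma>)"
      using k(4) by (simp add: qsdp_dual_def uminus_diffs_eq_0_iff)
    then show "tangent_cone (con_set (dual W)) (con_map (dual W) (\<omega>, \<xi>, \<Gamma>)) \<inter> orth_compl_of (x, \<Upsilon>) = C"
      by (simp only: C_def) (simp add: qsdp_dual_def tangent_cone_zero_times[OF ne] orth_compl_of_zero_times)
    show "con_deriv (dual W) (\<omega>, \<xi>, \<Gamma>) d = L d" if "d \<in> var_space (dual W)" for d
      using con_deriv_dual[of "(\<omega>, \<xi>, \<Gamma>)" d] that k by (simp add: L_def qsdp_dual_def)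
  qed (use C in \<open>auto simp: qsdp_dual_def L_def subspace_dual_space subspace_Times subspace_sym_mats\<close>)
  also have "\<dots> \<longleftrightarrow> (\<forall>d. (\<forall>a \<in> W. a \<bullet> Q d = 0) \<longrightarrow> H d = 0 \<longrightarrow> G d ** \<Gamma> = 0 \<longrightarrow> G d \<in> vanishing_on_kernel \<Upsilon> \<longrightarrow> d = 0)"
    (is "?l \<longleftrightarrow> ?r")
  proof -
    have "?l \<longleftrightarrow> (\<forall>d. \<forall>U \<in> sym_mats. (\<forall>w \<in> W \<times> UNIV \<times> sym_mats. L w \<bullet> (d, U) = 0) \<longrightarrow>
        (\<forall>s \<in> C. s \<bullet> (d, U) = 0) \<longrightarrow> d = 0 \<and> U = 0)"
      by (auto simp: qsdp_dual_def zero_prod_def)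
    also have "\<dots> \<longleftrightarrow> (\<forall>d. \<forall>U \<in> sym_mats. (\<forall>a \<in> W. a \<bullet> Q d = 0) \<and> H d = 0 \<and> U = G d \<longrightarrow>
        U ** \<Gamma> = 0 \<and> U \<in> vanishing_on_kernel \<Upsilon> \<longrightarrow> d = 0 \<and> U = 0)"
      using L0 orth by (simp cong: ball_cong)
    \<comment> \<open>Substituting \<open>U = G d\<close> makes the conclusion \<open>U = 0\<close>
      a consequence of \<open>d = 0\<close>.\<close>
    also have "\<dots> \<longleftrightarrow> ?r"
      using Gd linear_0[OF G(1)] by metis
    finally show ?thesis .
  qed
  finally show ?thesis .
qed

end

end

section \<open>Matching the second order and qualification criteria of the two problems\<close>

theorem proposition7:
  fixes Q :: "'x::euclidean_space \<Rightarrow> 'x" and c :: 'x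
    and H :: "'x \<Rightarrow> real^'m" and p :: "real^'m"
    and G :: "'x \<Rightarrow> real^'n^'n" and q :: "real^'n^'n"
    and W :: "'x set"
  assumes "linear Q" and "\<And>x y. Q x \<bullet> y = x \<bullet> Q y" and "\<And>x. 0 \<le> x \<bullet> Q x"
    and "linear H"
    and "linear G" and "range G \<subseteq> sym_mats" and "q \<in> sym_mats"
    and "subspace W" and "range Q \<subseteq> W"
  shows
    "(W = UNIV \<longrightarrow>
       (\<forall>x \<xi> \<Gamma>.
          stationary_point (qsdp_primal Q c H p G q) x \<longrightarrow>
          (\<xi>, \<Gamma>) \<in> multipliers (qsdp_primal Q c H p G q) x \<longrightarrow>
          (W_SOC (qsdp_primal Q c H p G q) x (\<xi>, \<Gamma>) \<longleftrightarrow>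
           W_SRCQ (qsdp_dual W Q c H p G q) (x, \<xi>, \<Gamma>) (x, G x - q)))) \<and>
     (W = range Q \<longrightarrow>
       (\<forall>\<omega> \<xi> \<Gamma> x \<Upsilon>.
          stationary_point (qsdp_dual W Q c H p G q) (\<omega>, \<xi>, \<Gamma>) \<longrightarrow>
          (x, \<Upsilon>) \<in> multipliers (qsdp_dual W Q c H p G q) (\<omega>, \<xi>, \<Gamma>) \<longrightarrow>
          (W_SOC (qsdp_dual W Q c H p G q) (\<omega>, \<xi>, \<Gamma>) (x, \<Upsilon>) \<longleftrightarrow>
           W_SRCQ (qsdp_primal Q c H p G q) x (\<xi>, \<Gamma>))))"
proof (intro conjI impI allI)
  fix x \<xi> \<Gamma>
  assume W: "W = UNIV" and "(\<xi>, \<Gamma>) \<in> multipliers (qsdp_primal Q c H p G q) x"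
  then have P: "kkt_point (qsdp_primal Q c H p G q) x (\<xi>, \<Gamma>)"
    by (simp add: multipliers_def)
  then have "kkt_point (qsdp_dual W Q c H p G q) (x, \<xi>, \<Gamma>) (x, G x - q)"
    unfolding kkt_point_primal_iff[OF assms(1-7)] kkt_point_dual_iff[OF assms]
    using complementaryD(3) by (simp add: W) blast
  note D = W_SRCQ_dual_iff[OF assms this]
  \<comment> \<open>With \<open>W\<close> the whole space, testing \<open>Q d\<close> against all of
    \<open>W\<close> recovers the zero-curvature condition of the primal W-SOC.\<close>
  have "Q d = 0 \<longleftrightarrow> (\<forall>a \<in> W. a \<bullet> Q d = 0)" for d
    unfolding W by (metis UNIV_I inner_eq_zero_iff inner_zero_right)
  then show "W_SOC (qsdp_primal Q c H p G q) x (\<xi>, \<Gamma>) \<longleftrightarrow>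
      W_SRCQ (qsdp_dual W Q c H p G q) (x, \<xi>, \<Gamma>) (x, G x - q)"
    unfolding D W_SOC_primal_iff[OF assms(1-7) P] by blast
next
  fix \<omega> \<xi> \<Gamma> x \<Upsilon>
  assume W: "W = range Q"
    and "(x, \<Upsilon>) \<in> multipliers (qsdp_dual W Q c H p G q) (\<omega>, \<xi>, \<Gamma>)"
  then have D: "kkt_point (qsdp_dual W Q c H p G q) (\<omega>, \<xi>, \<Gamma>) (x, \<Upsilon>)"
    by (simp add: multipliers_def)
  then have \<Upsilon>: "\<Upsilon> = G x - q" and P: "kkt_point (qsdp_primal Q c H p G q) x (\<xi>, \<Gamma>)"
    unfolding kkt_point_primal_iff[OF assms(1-7)] kkt_point_dual_iff[OF assms] by auto
  have "a = 0" if a: "a \<in> W" "Q a = 0" for a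
  proof -
    obtain b where "a = Q b" using a W by blast
    \<comment> \<open>Self-adjointness moves \<open>Q\<close> across:
      \<open>Q b \<bullet> a = b \<bullet> Q a = 0\<close>.\<close>
    then have "a \<bullet> a = 0"
      using assms(2)[of b a] a(2) by simp
    then show ?thesis by simp
  qed
  then have "Q a = 0 \<longleftrightarrow> a = 0" if "a \<in> W" for a
    using that linear_0[OF assms(1)] by auto
  \<comment> \<open>Injectivity on \<open>W\<close> leaves only \<open>a = 0\<close>.
    \<open>F\<close> and \<open>F'\<close> stand for the two matrix conditions, which occur in
    opposite orders in the two criteria.\<close>
  then have "(\<forall>a\<in>W. \<forall>\<eta>. \<forall>V\<in>sym_mats. Q a + adjoint H \<eta> + adjoint G V = 0 \<longrightarrow> F V \<longrightarrow> F' V \<longrightarrow>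
        Q a = 0 \<longrightarrow> a = 0 \<and> \<eta> = 0 \<and> V = 0) \<longleftrightarrow>
      (\<forall>\<eta>. \<forall>V\<in>sym_mats. adjoint H \<eta> + adjoint G V = 0 \<longrightarrow> F' V \<longrightarrow> F V \<longrightarrow> \<eta> = 0 \<and> V = 0)" for F F'
    using subspace_0[OF assms(8)] linear_0[OF assms(1)] by fastforce
  then show "W_SOC (qsdp_dual W Q c H p G q) (\<omega>, \<xi>, \<Gamma>) (x, \<Upsilon>) \<longleftrightarrow>
      W_SRCQ (qsdp_primal Q c H p G q) x (\<xi>, \<Gamma>)"
    unfolding W_SOC_dual_iff[OF assms D] W_SRCQ_primal_iff[OF assms(1-7) P]
    unfolding \<Upsilon> .
qed

end
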